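(* Let $\lambda \geq 2$ be an integer. Then there exists a constant $C(\lambda)$, depending only on $\lambda$, such that for every sesqui-regular graph $G$ with parameters $(v,k,c)$, if $\lambda_{\min}(G) \geq -\lambda$ and $k \geq C(\lambda)$, then at least one of the following holds: (i) $c \leq \lambda^2(\lambda-1)$; (ii) $v-k-1 \leq \frac{(\lambda-1)^2}{4}+1$.
   Context: All graphs are finite, simple and undirected. A sesqui-regular graph with parameters $(v,k,c)$ is a $k$-regular graph on $v$ vertices such that any two vertices at distance $2$ have exactly $c$ common neighbours. $\lambda_{\min}(G)$ denotes the smallest eigenvalue of the adjacency matrix of $G$.
   Formalization: The graph G is additionally assumed connected; without this the claim fails, e.g. for two disjoint copies of the cocktail-party graph K_{t×2}, where k = c = 2t−2, the smallest eigenvalue is −2 and v−k−1 = 2t+1. *)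

theory Defs
  imports "Jordan_Normal_Form.Char_Poly"
begin

definition simple_graph :: "nat \<Rightarrow> (nat \<Rightarrow> nat \<Rightarrow> bool) \<Rightarrow> bool" where
  "simple_graph n E \<longleftrightarrow>
     (\<forall>i j. E i j \<longrightarrow> i < n \<and> j < n) \<and>
     (\<forall>i j. E i j \<longrightarrow> E j i) \<and>
     (\<forall>i. \<not> E i i)"

definition neighbours :: "nat \<Rightarrow> (nat \<Rightarrow> nat \<Rightarrow> bool) \<Rightarrow> nat \<Rightarrow> nat set" where
  "neighbours n E i = {j. j < n \<and> E i j}"

definition connected_graph :: "nat \<Rightarrow> (nat \<Rightarrow> nat \<Rightarrow> bool) \<Rightarrow> bool" where
  "connected_graph n E \<longleftrightarrow> (\<forall>i<n. \<forall>j<n. E\<^sup>*\<^sup>* i j)"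

definition dist2 :: "nat \<Rightarrow> (nat \<Rightarrow> nat \<Rightarrow> bool) \<Rightarrow> nat \<Rightarrow> nat \<Rightarrow> bool" where
  "dist2 n E i j \<longleftrightarrow> i < n \<and> j < n \<and> i \<noteq> j \<and> \<not> E i j \<and> (\<exists>w<n. E i w \<and> E w j)"

definition sesqui_regular :: "nat \<Rightarrow> (nat \<Rightarrow> nat \<Rightarrow> bool) \<Rightarrow> nat \<Rightarrow> nat \<Rightarrow> bool" where
  "sesqui_regular n E k c \<longleftrightarrow>
     simple_graph n E \<and>
     (\<forall>i<n. card (neighbours n E i) = k) \<and>
     (\<forall>i j. dist2 n E i j \<longrightarrow> card (neighbours n E i \<inter> neighbours n E j) = c)"

definition adjacency_matrix :: "nat \<Rightarrow> (nat \<Rightarrow> nat \<Rightarrow> bool) \<Rightarrow> real mat" where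
  "adjacency_matrix n E = mat n n (\<lambda>(i, j). if E i j then 1 else 0)"

text \<open>Smallest (real) eigenvalue of a real matrix (adjacency matrices are symmetric,
  so all eigenvalues are real).\<close>
definition lambda_min :: "real mat \<Rightarrow> real" where
  "lambda_min A = Min {a. eigenvalue A a}"

end

theory Submission
  imports Defs "HOL-Analysis.Function_Topology" "HOL-Library.Ramsey"
begin

text \<open>
  The eigenvalue hypothesis says that \<open>A + \<lambda> I\<close> is positive semidefinite; every forbidden
  configuration is excluded by a vector that is constant on at most three disjoint vertex sets.
  By Ramsey's theorem and the exclusion of the claw with \<open>\<lambda>\<^sup>2 + 1\<close> leaves, large sets of
  neighbours contain large cliques.

  If \<open>c\<close> is at most a constant \<open>D\<close>, a vertex outside a large maximal clique has at most
  \<open>\<lambda> (\<lambda> - 1)\<close> neighbours in it, a vertex lies in at most \<open>\<lambda>\<close> large maximal cliques, all its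
  neighbours but a bounded number are in these cliques, and there are no exceptions if it lies in
  exactly \<open>\<lambda>\<close> of them. Take a vertex \<open>x\<close> outside a very large clique \<open>Q\<close> but adjacent to it, and
  \<open>y\<close> in \<open>Q\<close> adjacent neither to \<open>x\<close> nor to an exceptional neighbour of \<open>x\<close> outside \<open>Q\<close>.
  The common neighbours of \<open>x\<close> and \<open>y\<close> lie in the large cliques at \<open>x\<close> or, if there are fewer than
  \<open>\<lambda>\<close> of these, in \<open>Q\<close>; hence \<open>c \<le> \<lambda> \<cdot> \<lambda> (\<lambda> - 1)\<close>.

  If \<open>c\<close> exceeds \<open>D\<close>, any two vertices at distance 2 are both adjacent to all of some large clique.
  The vertices adjacent to almost all of a large clique form a block, distinct blocks share few
  vertices and the cliques in a neighbourhood produce at most \<open>\<lambda>\<^sup>2\<close> blocks; connectivity then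
  forces a single block, so that \<open>v - k\<close> is bounded. The complement is regular of bounded degree
  with second largest eigenvalue at most \<open>\<lambda> - 1\<close>, and the Alon--Boppana bound gives (ii).
\<close>

section \<open>The smallest eigenvalue and the quadratic form\<close>

definition qform :: "'a set \<Rightarrow> ('a \<Rightarrow> 'a \<Rightarrow> real) \<Rightarrow> ('a \<Rightarrow> real) \<Rightarrow> ('a \<Rightarrow> real) \<Rightarrow> real" where
  "qform V a f g = (\<Sum>i\<in>V. \<Sum>j\<in>V. a i j * f i * g j)"

definition adj :: "('a \<Rightarrow> 'a \<Rightarrow> bool) \<Rightarrow> 'a \<Rightarrow> 'a \<Rightarrow> real" where
  "adj E i j = of_bool (E i j)"

lemma qform_add_left: "qform V a (\<lambda>i. f i + g i) h = qform V a f h + qform V a g h"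
  by (simp add: qform_def algebra_simps sum.distrib)

lemma qform_add_right: "qform V a h (\<lambda>i. f i + g i) = qform V a h f + qform V a h g"
  by (simp add: qform_def algebra_simps sum.distrib)

lemma qform_scale_left: "qform V a (\<lambda>i. s * f i) h = s * qform V a f h"
  by (simp add: qform_def algebra_simps sum_distrib_left)

lemma qform_scale_right: "qform V a h (\<lambda>i. s * f i) = s * qform V a h f"
  by (simp add: qform_def algebra_simps sum_distrib_left)

lemma qform_commute:
  assumes "\<And>i j. a i j = a j i"
  shows "qform V a f g = qform V a g f"
  unfolding qform_def
  by (subst sum.swap) (intro sum.cong refl, simp add: assms mult_ac)

text \<open>Functions on \<open>nat\<close> that vanish from \<open>n\<close> on stand in for R^n.
  The sphere is a closed subset of the cube of functions with values in [-1, 1], which is compact by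
  Tychonoff's theorem.\<close>

lemma compact_sphere_fun:
  "compact {f :: nat \<Rightarrow> real. (\<forall>i\<ge>n. f i = 0) \<and> (\<Sum>i<n. (f i)\<^sup>2) = 1}" (is "compact ?S")
proof -
  let ?C = "Pi\<^sub>E UNIV (\<lambda>_. {-1..1}) :: (nat \<Rightarrow> real) set"
  have "compactin (product_topology (\<lambda>_::nat. euclidean) UNIV) ?C"
    by (subst compactin_PiE) simp
  then have C: "compact ?C"
    by (simp add: euclidean_product_topology)
  have "closed {f :: nat \<Rightarrow> real. f i = 0}" for i
    by (intro closed_Collect_eq continuous_on_product_coordinates continuous_on_const)
  then have "closed (\<Inter>i\<in>{n..}. {f :: nat \<Rightarrow> real. f i = 0})"
    by (intro closed_INT) auto
  moreover have "closed {f :: nat \<Rightarrow> real. (\<Sum>i<n. (f i)\<^sup>2) = 1}"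
    by (intro closed_Collect_eq continuous_intros continuous_on_product_coordinates)
  ultimately have "closed ((\<Inter>i\<in>{n..}. {f :: nat \<Rightarrow> real. f i = 0}) \<inter> {f. (\<Sum>i<n. (f i)\<^sup>2) = 1})"
    by (rule closed_Int)
  also have "(\<Inter>i\<in>{n..}. {f :: nat \<Rightarrow> real. f i = 0}) \<inter> {f. (\<Sum>i<n. (f i)\<^sup>2) = 1} = ?S"
    by auto
  finally have "compact (?C \<inter> ?S)"
    using C by (intro compact_Int_closed)
  moreover have "?S \<subseteq> ?C"
  proof
    fix f :: "nat \<Rightarrow> real"
    assume f: "f \<in> ?S"
    have "f i \<in> {-1..1}" for i
    proof (cases "i < n")
      case True
      have "(f i)\<^sup>2 \<le> (\<Sum>i<n. (f i)\<^sup>2)"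
        using True by (intro member_le_sum) auto
      then have "(f i)\<^sup>2 \<le> 1" using f by simp
      then show ?thesis
        by (simp add: abs_square_le_1 abs_le_iff)
    qed (use f in auto)
    then show "f \<in> ?C" by auto
  qed
  ultimately show ?thesis
    by (simp add: Int_absorb1)
qed

text \<open>The form attains its minimum \<open>m\<close> on the compact unit sphere, and a
  minimiser is an eigenvector because the first variation vanishes there.\<close>

lemma symmetric_form_min_eigenvector:
  fixes a :: "nat \<Rightarrow> nat \<Rightarrow> real"
  assumes sym: "\<And>i j. a i j = a j i" and "n > 0"
  obtains x m where "\<exists>i<n. x i \<noteq> 0"
    and "\<And>i. i < n \<Longrightarrow> (\<Sum>j<n. a i j * x j) = m * x i"
    and "\<And>y. m * (\<Sum>i<n. (y i)\<^sup>2) \<le> qform {..<n} a y y"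
proof -
  define S where "S = {f :: nat \<Rightarrow> real. (\<forall>i\<ge>n. f i = 0) \<and> (\<Sum>i<n. (f i)\<^sup>2) = 1}"
  let ?q = "\<lambda>f. qform {..<n} a f f"
  have cont: "continuous_on S ?q"
    unfolding qform_def
    by (intro continuous_intros continuous_on_subset[OF continuous_on_product_coordinates]) auto
  have "(\<lambda>i. if i = 0 then 1 else 0) \<in> S"
    using \<open>n > 0\<close> by (auto simp: S_def if_distrib[of "\<lambda>x. x\<^sup>2"] cong: if_cong)
  then have "S \<noteq> {}" by blast
  from continuous_attains_inf[OF compact_sphere_fun[of n, folded S_def] this cont] obtain x where
    x: "x \<in> S" and min: "\<And>y. y \<in> S \<Longrightarrow> ?q x \<le> ?q y" by blast
  define m where "m = ?q x"
  have ge: "m * (\<Sum>i<n. (y i)\<^sup>2) \<le> ?q y" for y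
  proof (cases "(\<Sum>i<n. (y i)\<^sup>2) = 0")
    case True
    then have "\<forall>i<n. y i = 0" by (simp add: sum_nonneg_eq_0_iff)
    then have "?q y = 0" by (simp add: qform_def)
    then show ?thesis using True by simp
  next
    case False
    define s where "s = (\<Sum>i<n. (y i)\<^sup>2)"
    have s: "s > 0" using False by (simp add: s_def sum_nonneg less_le)
    define z where "z i = (if i < n then y i / sqrt s else 0)" for i
    have "(\<Sum>i<n. (z i)\<^sup>2) = (\<Sum>i<n. (y i)\<^sup>2 / s)"
      using s by (intro sum.cong) (auto simp: z_def power_divide)
    also have "\<dots> = s / s" unfolding sum_divide_distrib[symmetric] s_def ..
    finally have "z \<in> S" using s by (auto simp: S_def z_def)
    from min[OF this] have "m \<le> ?q z" by (simp add: m_def)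
    also have "?q z = ?q y / s"
      using s by (simp add: qform_def z_def sum_divide_distrib)
    finally show ?thesis using s by (simp add: s_def field_simps)
  qed
  \<comment> \<open>Half the derivative at \<open>x\<close>, in direction \<open>y\<close>, of the
    form minus \<open>m\<close> times the squared norm.\<close>
  let ?b = "\<lambda>y. qform {..<n} a x y - m * (\<Sum>i<n. x i * y i)"
  have b0: "?b y = 0" for y
  proof -
    let ?d = "?q y - m * (\<Sum>i<n. (y i)\<^sup>2)"
    have "0 \<le> 2 * t * ?b y + t\<^sup>2 * ?d" for t
    proof -
      have "(\<Sum>i<n. (x i + t * y i)\<^sup>2) = (\<Sum>i<n. (x i)\<^sup>2) + 2 * t * (\<Sum>i<n. x i * y i) + t\<^sup>2 * (\<Sum>i<n. (y i)\<^sup>2)"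
        by (simp add: power2_sum sum.distrib sum_distrib_left power_mult_distrib mult_ac)
      also have "(\<Sum>i<n. (x i)\<^sup>2) = 1" using x by (simp add: S_def)
      finally have "m * (1 + 2 * t * (\<Sum>i<n. x i * y i) + t\<^sup>2 * (\<Sum>i<n. (y i)\<^sup>2)) \<le> ?q (\<lambda>i. x i + t * y i)"
        using ge[of "\<lambda>i. x i + t * y i"] by simp
      also have "?q (\<lambda>i. x i + t * y i) = m + 2 * t * qform {..<n} a x y + t\<^sup>2 * ?q y"
        using qform_commute[OF sym, where V = "{..<n}" and f = x and g = y]
        by (simp add: qform_add_left qform_add_right qform_scale_left qform_scale_right m_def
            power2_eq_square algebra_simps)
      finally show ?thesis by (simp add: algebra_simps)
    qed
    then have *: "0 \<le> 2 * t * ?b y + t\<^sup>2 * ?d" for t .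
    show ?thesis
    proof (rule ccontr)
      assume b: "?b y \<noteq> 0"
      \<comment> \<open>A quadratic in t that is nonnegative and has no constant term has no linear
        term either. Enlarging \<open>?d\<close> to the positive number \<open>e\<close> makes t =
        -\<open>?b y\<close> / \<open>e\<close> a legitimate choice even when \<open>?d\<close> is
        not positive.\<close>
      define e where "e = \<bar>?d\<bar> + 1"
      have e: "e > 0" "?d < e" by (auto simp: e_def)
      have "0 \<le> 2 * (- ?b y / e) * ?b y + (- ?b y / e)\<^sup>2 * ?d" by (rule *)
      also have "\<dots> < 2 * (- ?b y / e) * ?b y + (- ?b y / e)\<^sup>2 * e"
        using b e by (intro add_strict_left_mono mult_strict_left_mono) auto
      also have "\<dots> = - (?b y)\<^sup>2 / e"
        using e by (simp add: field_simps power2_eq_square)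
      also have "\<dots> \<le> 0" using e by simp
      finally show False by simp
    qed
  qed
  have "(\<Sum>j<n. a i j * x j) = m * x i" if "i < n" for i
  proof -
    \<comment> \<open>The variation in the direction of the \<open>i\<close>-th unit vector is the
      \<open>i\<close>-th row of the eigenvector equation.\<close>
    have "qform {..<n} a x (\<lambda>j. if j = i then 1 else 0) = (\<Sum>j<n. a i j * x j)"
      using that by (simp add: qform_def if_distrib sum.delta' sym[of i] cong: if_cong)
    moreover have "(\<Sum>j<n. x j * (if j = i then 1 else 0)) = x i"
      using that by (simp add: if_distrib sum.delta' cong: if_cong)
    ultimately show ?thesis using b0[of "\<lambda>j. if j = i then 1 else 0"] by simp
  qed
  moreover have "\<exists>i<n. x i \<noteq> 0"
  proof (rule ccontr)
    assume "\<not> (\<exists>i<n. x i \<noteq> 0)"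
    then have "(\<Sum>i<n. (x i)\<^sup>2) = 0" by simp
    then show False using x by (simp add: S_def)
  qed
  ultimately show ?thesis using that ge by blast
qed

text \<open>\<open>lambda_min\<close> is defined by \<open>Min\<close>, which is a lower bound for
  the eigenvalues only once their set is known to be finite.\<close>

lemma finite_eigenvalues:
  assumes "(A :: real mat) \<in> carrier_mat n n"
  shows "finite {e. eigenvalue A e}"
proof (cases "n = 0")
  case True
  then show ?thesis
    using eigenvalue_imp_nonzero_dim[OF assms] by (metis (mono_tags, lifting) finite.emptyI Collect_empty_eq less_irrefl)
next
  case False
  have "char_poly A \<noteq> 0" using degree_monic_char_poly[OF assms] by auto
  then show ?thesis
    by (simp add: eigenvalue_root_char_poly[OF assms] poly_roots_finite)
qed

text \<open>The minimum of the Rayleigh quotient is itself an eigenvalue, so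
  \<open>lambda_min\<close> does not exceed it. For \<open>n = 0\<close> there are no eigenvalues to
  take the \<open>Min\<close> of, but both sides are zero.\<close>

lemma lambda_min_le_form:
  assumes "simple_graph n E"
  shows "lambda_min (adjacency_matrix n E) * (\<Sum>i<n. (f i)\<^sup>2) \<le> qform {..<n} (adj E) f f"
proof (cases "n = 0")
  case True
  then show ?thesis by (simp add: qform_def)
next
  case False
  let ?A = "adjacency_matrix n E"
  have A: "?A \<in> carrier_mat n n" by (simp add: adjacency_matrix_def)
  have "adj E i j = adj E j i" for i j
    using assms by (auto simp: adj_def simple_graph_def)
  with False obtain x m where x: "\<exists>i<n. x i \<noteq> 0"
    and ev: "\<And>i. i < n \<Longrightarrow> (\<Sum>j<n. adj E i j * x j) = m * x i"
    and ge: "\<And>y. m * (\<Sum>i<n. (y i)\<^sup>2) \<le> qform {..<n} (adj E) y y"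
    using symmetric_form_min_eigenvector[of "adj E" n] by blast
  have "eigenvector ?A (vec n x) m"
    unfolding eigenvector_def
  proof (intro conjI)
    show "vec n x \<noteq> 0\<^sub>v (dim_row ?A)"
      using x by (auto simp: adjacency_matrix_def vec_eq_iff)
    show "?A *\<^sub>v vec n x = m \<cdot>\<^sub>v vec n x"
    proof (rule eq_vecI)
      fix i assume "i < dim_vec (m \<cdot>\<^sub>v vec n x)"
      then have i: "i < n" by simp
      then have "(?A *\<^sub>v vec n x) $ i = (\<Sum>j<n. adj E i j * x j)"
        by (simp add: adjacency_matrix_def scalar_prod_def adj_def of_bool_def lessThan_atLeast0)
      then show "(?A *\<^sub>v vec n x) $ i = (m \<cdot>\<^sub>v vec n x) $ i"
        using i ev[OF i] by simp
    qed (simp add: adjacency_matrix_def)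
  qed (simp add: adjacency_matrix_def)
  then have "eigenvalue ?A m" by (auto simp: eigenvalue_def)
  then have "lambda_min ?A \<le> m"
    unfolding lambda_min_def using finite_eigenvalues[OF A] by (intro Min_le) auto
  then have "lambda_min ?A * (\<Sum>i<n. (f i)\<^sup>2) \<le> m * (\<Sum>i<n. (f i)\<^sup>2)"
    by (intro mult_right_mono sum_nonneg) auto
  then show ?thesis using ge[of f] by linarith
qed

section \<open>Forbidden configurations\<close>

text \<open>Some number with the Ramsey property, not necessarily the least one. It depends on the
  two sizes alone, as the final constant must not depend on the graph.\<close>

definition ramsey_bound :: "nat \<Rightarrow> nat \<Rightarrow> nat" where
  "ramsey_bound m n = (SOME r. \<forall>(V::nat set) (E::nat set set). finite V \<and> card V \<ge> r \<longrightarrow>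
    (\<exists>R \<subseteq> V. card R = m \<and> clique R E \<or> card R = n \<and> indep R E))"

lemma ramsey_bound:
  assumes "finite (V :: nat set)" "ramsey_bound m n \<le> card V"
  shows "\<exists>R \<subseteq> V. card R = m \<and> clique R E \<or> card R = n \<and> indep R E"
proof -
  have "\<exists>r. \<forall>(V::nat set) (E::nat set set). finite V \<and> card V \<ge> r \<longrightarrow>
    (\<exists>R \<subseteq> V. card R = m \<and> clique R E \<or> card R = n \<and> indep R E)"
    using ramsey2[where 'a = nat, of m n] by blast
  from someI_ex[OF this] show ?thesis
    using assms unfolding ramsey_bound_def by blast
qed

text \<open>Only the spectral bound is built in; regularity, connectivity and counts of common
  neighbours enter as hypotheses of single lemmas. The numerical constants defined in this locale
  depend on \<open>l\<close> alone.\<close>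

locale form_bounded_graph =
  fixes V :: "nat set" and E :: "nat \<Rightarrow> nat \<Rightarrow> bool" and l :: nat
  assumes finite_V: "finite V"
    and edge_in_V: "E x y \<Longrightarrow> x \<in> V \<and> y \<in> V"
    and edge_sym: "E x y \<Longrightarrow> E y x"
    and edge_irrefl: "\<not> E x x"
    and two_le_l: "2 \<le> l"
    and form_ge: "- real l * (\<Sum>i\<in>V. (f i)\<^sup>2) \<le> qform V (adj E) f f"
begin

section \<open>Neighbourhoods, cliques and edge counts\<close>

definition nb :: "nat \<Rightarrow> nat set" where
  "nb x = {y. E x y}"

definition is_clique :: "nat set \<Rightarrow> bool" where
  "is_clique K \<longleftrightarrow> K \<subseteq> V \<and> (\<forall>x\<in>K. \<forall>y\<in>K. x \<noteq> y \<longrightarrow> E x y)"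

text \<open>Ordered pairs are counted, so an edge inside \<open>A\<close> contributes 2 to
  \<open>edges_between A A\<close>, just as in the quadratic form.\<close>

definition edges_between :: "nat set \<Rightarrow> nat set \<Rightarrow> real" where
  "edges_between A B = (\<Sum>i\<in>A. \<Sum>j\<in>B. adj E i j)"

lemma mem_nb [simp]: "y \<in> nb x \<longleftrightarrow> E x y"
  by (simp add: nb_def)

lemma nb_subset_V: "nb x \<subseteq> V"
  using edge_in_V by auto

lemma finite_nb [simp]: "finite (nb x)"
  using finite_subset[OF nb_subset_V finite_V] .

lemma edge_commute: "E x y \<longleftrightarrow> E y x"
  using edge_sym by blast

lemma is_clique_subset: "is_clique K \<Longrightarrow> K' \<subseteq> K \<Longrightarrow> is_clique K'"
  by (auto simp: is_clique_def)

lemma is_clique_finite: "is_clique K \<Longrightarrow> finite K"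
  using finite_subset finite_V by (auto simp: is_clique_def)

lemma edges_between_commute: "edges_between A B = edges_between B A"
  unfolding edges_between_def by (subst sum.swap) (simp add: adj_def edge_commute)

lemma edges_between_complete:
  "(\<And>x y. x \<in> A \<Longrightarrow> y \<in> B \<Longrightarrow> E x y) \<Longrightarrow> edges_between A B = real (card A) * real (card B)"
  by (simp add: edges_between_def adj_def)

lemma edges_between_none:
  "(\<And>x y. x \<in> A \<Longrightarrow> y \<in> B \<Longrightarrow> \<not> E x y) \<Longrightarrow> edges_between A B = 0"
  by (simp add: edges_between_def adj_def)

lemma edges_between_clique:
  assumes "is_clique K"
  shows "edges_between K K = real (card K) * (real (card K) - 1)"
proof -
  have fin: "finite K" using assms by (rule is_clique_finite)
  have "(\<Sum>j\<in>K. adj E i j) = real (card K) - 1" if "i \<in> K" for i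
  proof -
    have "(\<Sum>j\<in>K. adj E i j) = adj E i i + (\<Sum>j\<in>K - {i}. adj E i j)"
      using that fin by (simp add: sum.remove)
    also have "(\<Sum>j\<in>K - {i}. adj E i j) = (\<Sum>j\<in>K - {i}. 1)"
      using assms that by (intro sum.cong) (auto simp: is_clique_def adj_def)
    also have "\<dots> = real (card K) - 1"
      using that fin by (simp add: of_nat_diff card_gt_0_iff Suc_leI) (metis One_nat_def Suc_leI card_gt_0_iff empty_iff of_nat_1 of_nat_diff)
    finally show ?thesis by (simp add: adj_def edge_irrefl)
  qed
  then show ?thesis by (simp add: edges_between_def)
qed

text \<open>This is \<open>form_ge\<close> for the function with values \<open>a\<close>,
  \<open>b\<close>, \<open>c\<close> on the three sets and 0 elsewhere. Each exclusion below picks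
  sets and weights that would make the right-hand side negative.\<close>

lemma three_part_form:
  assumes "A \<subseteq> V" "B \<subseteq> V" "C \<subseteq> V"
    and disj: "A \<inter> B = {}" "A \<inter> C = {}" "B \<inter> C = {}"
  shows "0 \<le> a\<^sup>2 * edges_between A A + b\<^sup>2 * edges_between B B + c\<^sup>2 * edges_between C C
    + 2 * a * b * edges_between A B + 2 * a * c * edges_between A C + 2 * b * c * edges_between B C
    + real l * (a\<^sup>2 * real (card A) + b\<^sup>2 * real (card B) + c\<^sup>2 * real (card C))"
proof -
  define ind :: "nat set \<Rightarrow> nat \<Rightarrow> real" where "ind S i = of_bool (i \<in> S)" for S i
  define f where "f i = a * ind A i + (b * ind B i + c * ind C i)" for i
  have e: "qform V (adj E) (ind S) (ind T) = edges_between S T" if "S \<subseteq> V" "T \<subseteq> V" for S T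
  proof -
    have "qform V (adj E) (ind S) (ind T) = (\<Sum>i\<in>V. if i \<in> S then \<Sum>j\<in>V. if j \<in> T then adj E i j else 0 else 0)"
      unfolding qform_def by (intro sum.cong refl) (auto simp: ind_def intro!: sum.cong)
    also have "\<dots> = edges_between S T"
      unfolding edges_between_def using finite_V that
      by (simp flip: sum.inter_restrict add: Int_absorb1)
    finally show ?thesis .
  qed
  have n: "(\<Sum>i\<in>V. ind S i) = real (card S)" if "S \<subseteq> V" for S
    using that finite_V by (simp add: ind_def of_bool_def flip: sum.inter_restrict) (simp add: Int_absorb1 flip: sum.inter_restrict)
  have "(f i)\<^sup>2 = a\<^sup>2 * ind A i + b\<^sup>2 * ind B i + c\<^sup>2 * ind C i" for i
    using disj by (auto simp: f_def ind_def)
  then have "(\<Sum>i\<in>V. (f i)\<^sup>2) = a\<^sup>2 * real (card A) + b\<^sup>2 * real (card B) + c\<^sup>2 * real (card C)"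
    using assms by (simp add: sum.distrib n flip: sum_distrib_left)
  moreover have "qform V (adj E) f f = a\<^sup>2 * edges_between A A + b\<^sup>2 * edges_between B B + c\<^sup>2 * edges_between C C
    + 2 * a * b * edges_between A B + 2 * a * c * edges_between A C + 2 * b * c * edges_between B C"
    unfolding f_def
    using assms edges_between_commute[of B A] edges_between_commute[of C A] edges_between_commute[of C B]
    by (simp add: qform_add_left qform_add_right qform_scale_left qform_scale_right e
        power2_eq_square algebra_simps)
  ultimately show ?thesis using form_ge[of f] by simp
qed

text \<open>Weight \<open>l\<close> on the centre and -1 on \<open>l^2 + 1\<close> independent
  leaves give the value \<open>-l\<close>.\<close>

lemma no_large_claw:
  assumes "S \<subseteq> nb y" and indep: "\<And>u w. u \<in> S \<Longrightarrow> w \<in> S \<Longrightarrow> \<not> E u w"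
  shows "card S \<le> l\<^sup>2"
proof (rule ccontr)
  assume "\<not> card S \<le> l\<^sup>2"
  then have "l\<^sup>2 + 1 \<le> card S" by simp
  then obtain T where T: "T \<subseteq> S" "card T = l\<^sup>2 + 1"
    by (rule obtain_subset_with_card_n)
  then have "card T > 0" by simp
  then obtain u where "u \<in> T" by (auto simp: card_gt_0_iff)
  then have "y \<in> V" using T assms(1) edge_in_V by auto
  have e1: "edges_between T T = 0" using T indep by (intro edges_between_none) auto
  have e2: "edges_between {y} T = l\<^sup>2 + 1"
    using T assms(1) by (subst edges_between_complete) auto
  have e3: "edges_between {y} {y} = 0" by (intro edges_between_none) (auto simp: edge_irrefl)
  have "T \<subseteq> V" "y \<notin> T" using T assms(1) nb_subset_V edge_irrefl by auto
  with three_part_form[of "{y}" T "{}" "real l" "-1" 0] \<open>y \<in> V\<close>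
  have "0 \<le> - 2 * real l * (l\<^sup>2 + 1) + real l * (l\<^sup>2 + (l\<^sup>2 + 1))"
    by (simp add: e1 e2 e3 T(2) add_ac)
  also have "\<dots> = - real l" by (simp add: algebra_simps power2_eq_square)
  finally show False using two_le_l by simp
qed

text \<open>Take 2 \<open>l^2\<close> neighbours and 2 \<open>l^2\<close> non-neighbours of
  \<open>y\<close> in the clique. With weights -1 and 1 on them the quadratically growing terms
  cancel, and weight 2 \<open>l\<close> on \<open>y\<close> brings the total to -4
  \<open>l^2\<close>.\<close>

lemma clique_few_neighbours_or_few_nonneighbours:
  assumes K: "is_clique K" and "y \<in> V"
  shows "card (K \<inter> nb y) < 2 * l\<^sup>2 \<or> card (K - nb y) < 2 * l\<^sup>2"
proof (rule ccontr)
  let ?t = "2 * l\<^sup>2"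
  assume "\<not> ?thesis"
  then have "?t \<le> card (K \<inter> nb y)" "?t \<le> card (K - nb y)" by auto
  then obtain W U where W: "W \<subseteq> K \<inter> nb y" "card W = ?t" and U: "U \<subseteq> K - nb y" "card U = ?t"
    by (meson obtain_subset_with_card_n)
  have l: "real l \<ge> 2" using two_le_l by simp
  have "y \<notin> K"
  proof
    assume "y \<in> K"
    then have "U \<subseteq> {y}" using U(1) K unfolding is_clique_def by force
    then have "card U \<le> 1" using card_mono[of "{y}" U] by simp
    moreover have "2\<^sup>2 \<le> l\<^sup>2" using two_le_l by (rule power_mono) simp
    ultimately show False using U by simp
  qed
  have c: "is_clique W" "is_clique U" using W U K is_clique_subset by blast+
  have e0: "edges_between {y} {y} = 0" by (intro edges_between_none) (auto simp: edge_irrefl)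
  have e1: "edges_between {y} W = ?t" using W by (subst edges_between_complete) auto
  have e2: "edges_between {y} U = 0" using U by (subst edges_between_none) auto
  have e3: "edges_between W U = real ?t * ?t"
    using W U K by (subst edges_between_complete) (force simp: is_clique_def)+
  have "W \<subseteq> V" "U \<subseteq> V" "W \<inter> U = {}" "y \<notin> W" "y \<notin> U"
    using W U K \<open>y \<notin> K\<close> by (auto simp: is_clique_def)
  with three_part_form[of "{y}" W U "2 * real l" "-1" 1] \<open>y \<in> V\<close>
  have "0 \<le> 2 * (real ?t * (real ?t - 1)) - 4 * real l * ?t - 2 * (real ?t * ?t) + real l * (4 * l\<^sup>2 + 2 * ?t)"
    by (simp add: edges_between_clique c W(2) U(2) e0 e1 e2 e3)
  also have "\<dots> = - (4 * real l ^ 2)"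
    by (simp add: algebra_simps power2_eq_square power3_eq_cube)
  also have "\<dots> < 0" using l by simp
  finally show False by simp
qed

text \<open>Spread a total weight \<open>p\<close> evenly over the many non-neighbours
  \<open>T\<close>, to balance weight -1 on \<open>p\<close> neighbours of \<open>y\<close>; the
  clique then carries total weight zero and the squares on \<open>T\<close> cost only
  \<open>p^2 / t\<close>. With \<open>l - 1\<close> on \<open>y\<close> the value is (l - 1)(l(l -
  1) - p + p^2/t), which is negative for p = l(l - 1) + 1 and t > 2 p^2.\<close>

lemma card_clique_Int_nb_le:
  assumes K: "is_clique K" and "y \<in> V" "y \<notin> K"
    and large: "2 * (l * (l - 1) + 1)\<^sup>2 < card (K - nb y)"
  shows "card (K \<inter> nb y) \<le> l * (l - 1)"
proof (rule ccontr)
  define p where "p = l * (l - 1) + 1"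
  assume "\<not> ?thesis"
  then have "p \<le> card (K \<inter> nb y)" by (simp add: p_def)
  then obtain W where W: "W \<subseteq> K \<inter> nb y" "card W = p"
    by (rule obtain_subset_with_card_n)
  define T where "T = K - nb y"
  define t where "t = real (card T)"
  have t: "t > 2 * (real p)\<^sup>2"
    using large unfolding t_def T_def p_def[symmetric]
    by (metis of_nat_less_iff of_nat_mult of_nat_numeral of_nat_power)
  then have "t > 0" by (smt (verit) zero_le_power2)
  have l: "real l \<ge> 2" using two_le_l by simp
  have c: "is_clique W" "is_clique T" using W K is_clique_subset by (auto simp: T_def)
  have e0: "edges_between {y} {y} = 0" by (intro edges_between_none) (auto simp: edge_irrefl)
  have e1: "edges_between {y} W = p" using W by (subst edges_between_complete) auto
  have e2: "edges_between {y} T = 0" by (subst edges_between_none) (auto simp: T_def)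
  have e3: "edges_between W T = real p * t"
    using W K by (subst edges_between_complete) (force simp: is_clique_def T_def t_def)+
  have "W \<subseteq> V" "T \<subseteq> V" "W \<inter> T = {}" "y \<notin> W" "y \<notin> T"
    using W K \<open>y \<notin> K\<close> by (auto simp: is_clique_def T_def)
  with three_part_form[of "{y}" W T "real l - 1" "-1" "p / t"] \<open>y \<in> V\<close>
  have "0 \<le> real p * (real p - 1) + (p / t)\<^sup>2 * (t * (t - 1)) - 2 * (real l - 1) * p - 2 * (p / t) * (real p * t)
     + real l * ((real l - 1)\<^sup>2 + p + (p / t)\<^sup>2 * t)"
    using \<open>t > 0\<close>
    by (simp add: edges_between_clique c W(2) e0 e1 e2 e3 left_diff_distrib flip: t_def)
  also have "(p / t)\<^sup>2 * (t * (t - 1)) = (real p)\<^sup>2 - (real p)\<^sup>2 / t"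
    using \<open>t > 0\<close> by (simp add: field_simps power2_eq_square)
  also have "2 * (p / t) * (real p * t) = 2 * (real p)\<^sup>2"
    using \<open>t > 0\<close> by (simp add: field_simps power2_eq_square)
  also have "(p / t)\<^sup>2 * t = (real p)\<^sup>2 / t"
    using \<open>t > 0\<close> by (simp add: field_simps power2_eq_square)
  also have "real p * (real p - 1) + ((real p)\<^sup>2 - (real p)\<^sup>2 / t) - 2 * (real l - 1) * real p - 2 * (real p)\<^sup>2
      + real l * ((real l - 1)\<^sup>2 + real p + (real p)\<^sup>2 / t)
    = (real l - 1) * (real l * (real l - 1) - p) + (real l - 1) * ((real p)\<^sup>2 / t)"
    by (simp add: algebra_simps diff_divide_distrib power2_eq_square)
  also have "real l * (real l - 1) - p = - 1"
    using two_le_l by (simp add: p_def of_nat_diff)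
  also have "(real l - 1) * - 1 + (real l - 1) * ((real p)\<^sup>2 / t) = (real l - 1) * ((real p)\<^sup>2 / t - 1)"
    by (simp add: algebra_simps)
  also have "\<dots> < 0"
  proof (rule mult_pos_neg)
    have "(real p)\<^sup>2 < t" using t zero_le_power2[of "real p"] by linarith
    then show "(real p)\<^sup>2 / t - 1 < 0" using \<open>t > 0\<close> by simp
  qed (use l in simp)
  finally show False by simp
qed

text \<open>An independent set of size \<open>l^2 + 1\<close> with a common neighbour is an excluded
  claw, so Ramsey's theorem leaves only the clique. The common neighbour may vary with
  \<open>T\<close>, which is needed for subsets of blocks.\<close>

lemma ramsey_clique:
  assumes "S \<subseteq> V" "ramsey_bound m (l\<^sup>2 + 1) \<le> card S"
    and common: "\<And>T. T \<subseteq> S \<Longrightarrow> card T = l\<^sup>2 + 1 \<Longrightarrow> \<exists>y. T \<subseteq> nb y"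
  obtains K where "K \<subseteq> S" "is_clique K" "card K = m"
proof -
  have "finite S" using assms(1) finite_V by (rule finite_subset)
  from ramsey_bound[OF this assms(2), of "{{x, y} |x y. E x y}"]
  obtain R where R: "R \<subseteq> S"
    "card R = m \<and> clique R {{x, y} |x y. E x y} \<or> card R = l\<^sup>2 + 1 \<and> indep R {{x, y} |x y. E x y}"
    by blast
  have *: "{u, w} \<in> {{x, y} |x y. E x y} \<longleftrightarrow> E u w" for u w
    using edge_commute by (auto simp: doubleton_eq_iff)
  show ?thesis
  proof (cases "card R = m \<and> clique R {{x, y} |x y. E x y}")
    case True
    then have "is_clique R"
      using R(1) assms(1) unfolding clique_def * by (auto simp: is_clique_def)
    then show ?thesis using that R(1) True by blast
  next
    case False
    then have card: "card R = l\<^sup>2 + 1" and ind: "\<And>u w. u \<in> R \<Longrightarrow> w \<in> R \<Longrightarrow> u \<noteq> w \<Longrightarrow> \<not> E u w"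
      using R(2) unfolding indep_def * by blast+
    obtain y where "R \<subseteq> nb y" using common[OF R(1) card] by blast
    then have "card R \<le> l\<^sup>2" using ind edge_irrefl by (intro no_large_claw[of R y]) metis+
    then show ?thesis using card by simp
  qed
qed

text \<open>Greedy choice: when \<open>T i\<close> is picked, the vertices chosen so far exclude at
  most \<open>card I * (m * d)\<close> elements of \<open>A i\<close>.\<close>

lemma separated_subsets:
  assumes "finite I"
    and fin: "\<And>i. i \<in> I \<Longrightarrow> finite (A i)"
    and large: "\<And>i. i \<in> I \<Longrightarrow> m + card I * (m * d) \<le> card (A i)"
    and sep: "\<And>i j a. i \<in> I \<Longrightarrow> j \<in> I \<Longrightarrow> i \<noteq> j \<Longrightarrow> a \<in> A i \<Longrightarrow> card (A j \<inter> nb a) \<le> d"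
  shows "\<exists>T. (\<forall>i\<in>I. T i \<subseteq> A i \<and> card (T i) = m) \<and>
    (\<forall>i\<in>I. \<forall>j\<in>I. i \<noteq> j \<longrightarrow> (\<forall>x\<in>T i. \<forall>y\<in>T j. \<not> E x y))"
proof -
  have "\<exists>T. (\<forall>i\<in>J. T i \<subseteq> A i \<and> card (T i) = m) \<and>
      (\<forall>i\<in>J. \<forall>j\<in>J. i \<noteq> j \<longrightarrow> (\<forall>x\<in>T i. \<forall>y\<in>T j. \<not> E x y))" if "J \<subseteq> I" for J
    using finite_subset[OF that \<open>finite I\<close>] that
  proof (induction J rule: finite_induct)
    case empty
    then show ?case by simp
  next
    case (insert i J)
    from insert.IH insert.prems obtain T where T_all: "\<forall>i\<in>J. T i \<subseteq> A i \<and> card (T i) = m"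
      and ind: "\<forall>i\<in>J. \<forall>j\<in>J. i \<noteq> j \<longrightarrow> (\<forall>x\<in>T i. \<forall>y\<in>T j. \<not> E x y)"
      by blast
    from T_all have T: "\<And>i. i \<in> J \<Longrightarrow> T i \<subseteq> A i" "\<And>i. i \<in> J \<Longrightarrow> card (T i) = m"
      by auto
    have finT: "finite (T j)" if "j \<in> J" for j
      using T(1)[OF that] fin[of j] that insert.prems by (auto intro: finite_subset)
    \<comment> \<open>The candidates in \<open>A i\<close> spoiled by an already chosen
      vertex.\<close>
    define X where "X = (\<Union>j\<in>J. \<Union>x\<in>T j. A i \<inter> nb x)"
    have "card X \<le> (\<Sum>j\<in>J. \<Sum>x\<in>T j. card (A i \<inter> nb x))"
      unfolding X_def
      using insert.hyps(1) finT
      by (intro order_trans[OF card_UN_le] sum_mono card_UN_le) auto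
    also have "\<dots> \<le> (\<Sum>j\<in>J. \<Sum>x\<in>T j. d)"
    proof (intro sum_mono)
      fix j x assume "j \<in> J" "x \<in> T j"
      then show "card (A i \<inter> nb x) \<le> d"
        using insert.hyps insert.prems T(1) by (intro sep[of j i x]) auto
    qed
    also have "\<dots> = card J * (m * d)" using T(2) by simp
    also have "\<dots> \<le> card I * (m * d)"
      using insert.prems \<open>finite I\<close> by (intro mult_right_mono card_mono) auto
    finally have "m + card X \<le> card (A i)"
      using large[of i] insert.prems by simp
    moreover have "card (A i - X) \<ge> card (A i) - card X"
      by (rule diff_card_le_card_Diff) (auto simp: X_def insert.hyps finT)
    ultimately have "m \<le> card (A i - X)" by simp
    then obtain Y where Y: "Y \<subseteq> A i - X" "card Y = m"
      by (rule obtain_subset_with_card_n)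
    have "\<not> E x y" if "j \<in> J" "x \<in> T j" "y \<in> Y" for j x y
      using that Y(1) unfolding X_def by fastforce
    moreover from this have "\<not> E y x" if "j \<in> J" "x \<in> T j" "y \<in> Y" for j x y
      using that edge_sym by blast
    ultimately show ?case
      using T ind Y insert.hyps
      by (intro exI[of _ "T(i := Y)"]) (auto simp: subset_iff)
  qed
  then show ?thesis by blast
qed

end

section \<open>Blocks: many common neighbours\<close>

context form_bounded_graph
begin

text \<open>With the cutoff \<open>2 * l^2\<close> the dichotomy for cliques becomes a dichotomy for
  vertices: outside the block of a clique, a vertex has fewer than \<open>2 * l^2\<close> neighbours
  in it.\<close>

definition block :: "nat set \<Rightarrow> nat set" where
  "block K = {y \<in> V. card (K - nb y) < 2 * l\<^sup>2}"

definition nonneighbour_bound :: nat where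
  "nonneighbour_bound = ramsey_bound (2 * l\<^sup>2) (l\<^sup>2 + 1)"

text \<open>In a clique of this size, any \<open>l^2 + 1\<close> vertices of its block have a common
  neighbour, any \<open>2 * l^2 + 1\<close> of them have at least \<open>2 * l^2\<close> common
  neighbours, and \<open>2 * l^2\<close> vertices remain after deleting
  \<open>nonneighbour_bound\<close> many.\<close>

definition block_threshold :: nat where
  "block_threshold = 4 * l ^ 4 + 4 * l\<^sup>2 + nonneighbour_bound + 1"

lemma l_squared_ge_4: "4 \<le> l\<^sup>2"
  using power_mono[OF two_le_l, of 2] by simp

lemma block_threshold_ge:
  "2 * l\<^sup>2 * (l\<^sup>2 + 1) < block_threshold"
  "2 * l\<^sup>2 * (2 * l\<^sup>2) + 2 * l\<^sup>2 + 2 * l\<^sup>2 \<le> block_threshold"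
  "nonneighbour_bound + 2 * l\<^sup>2 \<le> block_threshold"
  by (simp_all add: block_threshold_def algebra_simps power2_eq_square power4_eq_xxxx)

lemma block_subset_V: "block K \<subseteq> V"
  by (auto simp: block_def)

lemma finite_block: "finite (block K)"
  using block_subset_V finite_V by (rule finite_subset)

lemma clique_subset_block:
  assumes "is_clique K"
  shows "K \<subseteq> block K"
proof
  fix y assume "y \<in> K"
  then have "K - nb y \<subseteq> {y}" using assms by (force simp: is_clique_def)
  then have "card (K - nb y) \<le> 1" using card_mono[of "{y}" "K - nb y"] by simp
  then show "y \<in> block K"
    using \<open>y \<in> K\<close> assms l_squared_ge_4 by (auto simp: block_def is_clique_def)
qed

lemma not_in_block: "is_clique K \<Longrightarrow> y \<in> V \<Longrightarrow> y \<notin> block K \<Longrightarrow> card (K \<inter> nb y) < 2 * l\<^sup>2"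
  using clique_few_neighbours_or_few_nonneighbours[of K y] by (auto simp: block_def)

lemma common_neighbours_in_clique:
  assumes "finite K" "finite T" "T \<subseteq> block K"
  shows "card K \<le> card (K \<inter> (\<Inter>z\<in>T. nb z)) + card T * (2 * l\<^sup>2)"
proof -
  have "card K \<le> card ((K \<inter> (\<Inter>z\<in>T. nb z)) \<union> (\<Union>z\<in>T. K - nb z))"
    using assms by (intro card_mono) auto
  also have "\<dots> \<le> card (K \<inter> (\<Inter>z\<in>T. nb z)) + card (\<Union>z\<in>T. K - nb z)"
    by (rule card_Un_le)
  also have "card (\<Union>z\<in>T. K - nb z) \<le> (\<Sum>z\<in>T. card (K - nb z))"
    using assms by (intro card_UN_le)
  also have "\<dots> \<le> (\<Sum>z\<in>T. 2 * l\<^sup>2)"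
    using assms(3) by (intro sum_mono) (auto simp: block_def)
  finally show ?thesis by simp
qed

text \<open>\<open>S\<close> need not lie in one neighbourhood, but any \<open>l^2 + 1\<close>
  vertices of the block share a neighbour in \<open>K\<close>, so large claws are still the only
  obstruction.\<close>

lemma ramsey_clique_in_block:
  assumes "is_clique K" "block_threshold \<le> card K"
    and "S \<subseteq> block K" "ramsey_bound m (l\<^sup>2 + 1) \<le> card S"
  obtains M where "M \<subseteq> S" "is_clique M" "card M = m"
proof (rule ramsey_clique[OF _ assms(4)])
  show "S \<subseteq> V" using assms(3) block_subset_V by blast
  fix T assume T: "T \<subseteq> S" "card T = l\<^sup>2 + 1"
  then have "finite T" by (metis card.infinite add_is_0 one_neq_zero)
  have "card K \<le> card (K \<inter> (\<Inter>z\<in>T. nb z)) + card T * (2 * l\<^sup>2)"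
    using T assms \<open>finite T\<close> is_clique_finite[OF assms(1)]
    by (intro common_neighbours_in_clique) auto
  then have "0 < card (K \<inter> (\<Inter>z\<in>T. nb z))"
    using assms(2) block_threshold_ge(1) T(2) by (simp add: mult.commute)
  then obtain y where "y \<in> K \<inter> (\<Inter>z\<in>T. nb z)" by (metis card_gt_0_iff ex_in_conv)
  then have "T \<subseteq> nb y" using edge_commute by auto
  then show "\<exists>y. T \<subseteq> nb y" by blast
qed blast

text \<open>Otherwise Ramsey's theorem yields a clique \<open>M\<close> of \<open>2 * l^2\<close>
  non-neighbours of \<open>y\<close> in the block. Together with the common neighbours in
  \<open>K\<close> of \<open>y\<close> and \<open>M\<close> it forms a clique that \<open>y\<close>
  splits into two parts too large for the dichotomy.\<close>

lemma card_block_nonneighbours: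
  assumes K: "is_clique K" "block_threshold \<le> card K" and y: "y \<in> block K"
  shows "card (block K - nb y) < nonneighbour_bound"
proof (rule ccontr)
  assume "\<not> ?thesis"
  then have "ramsey_bound (2 * l\<^sup>2) (l\<^sup>2 + 1) \<le> card (block K - nb y)"
    by (simp add: nonneighbour_bound_def)
  from ramsey_clique_in_block[OF K Diff_subset this]
  obtain M where M: "M \<subseteq> block K - nb y" "is_clique M" "card M = 2 * l\<^sup>2" .
  define K' where "K' = K \<inter> (\<Inter>z\<in>insert y M. nb z)"
  have fin: "finite (insert y M)" using M(2) is_clique_finite by simp
  have "card K \<le> card K' + card (insert y M) * (2 * l\<^sup>2)"
    unfolding K'_def using fin M(1) y is_clique_finite[OF K(1)]
    by (intro common_neighbours_in_clique) auto
  also have "card (insert y M) \<le> 2 * l\<^sup>2 + 1" using M(3) fin by (simp add: card_insert_if)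
  finally have "2 * l\<^sup>2 \<le> card K'"
    using K(2) block_threshold_ge(2) by (simp add: algebra_simps)
  also have "\<dots> \<le> card ((K' \<union> M) \<inter> nb y)"
    using fin is_clique_finite[OF K(1)] by (intro card_mono) (auto simp: K'_def)
  finally have 1: "2 * l\<^sup>2 \<le> card ((K' \<union> M) \<inter> nb y)" .
  have 2: "2 * l\<^sup>2 \<le> card ((K' \<union> M) - nb y)"
    unfolding M(3)[symmetric] using fin is_clique_finite[OF K(1)] M(1)
    by (intro card_mono) (auto simp: K'_def)
  have "is_clique (K' \<union> M)"
    using K(1) M(2) unfolding is_clique_def K'_def by (auto simp: edge_commute)
  from clique_few_neighbours_or_few_nonneighbours[OF this, of y] 1 2 y show False
    by (auto simp: block_def)
qed

text \<open>A vertex of \<open>block K\<close> misses fewer than \<open>nonneighbour_bound\<close>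
  vertices of \<open>M\<close>, hence sees at least \<open>2 * l^2\<close> of them, and the
  dichotomy puts it into \<open>block M\<close>.\<close>

lemma block_eq:
  assumes K: "is_clique K" "block_threshold \<le> card K"
    and M: "is_clique M" "block_threshold \<le> card M" and "M \<subseteq> block K"
  shows "block M = block K"
proof -
  have sub: "block K \<subseteq> block M" if K: "is_clique K" "block_threshold \<le> card K"
    and M: "is_clique M" "block_threshold \<le> card M" and MK: "M \<subseteq> block K" for K M
  proof
    fix y assume y: "y \<in> block K"
    have "card (M - nb y) \<le> card (block K - nb y)"
      using MK finite_block by (intro card_mono) auto
    also have "\<dots> < nonneighbour_bound" using K y by (rule card_block_nonneighbours)
    finally have "card (M - nb y) < nonneighbour_bound" .
    moreover have "card M = card (M \<inter> nb y) + card (M - nb y)"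
      using card_Int_Diff is_clique_finite[OF M(1)] .
    ultimately have "2 * l\<^sup>2 \<le> card (M \<inter> nb y)"
      using M(2) block_threshold_ge(3) by simp
    then show "y \<in> block M"
      using not_in_block[OF M(1), of y] y by (force simp: block_def)
  qed
  \<comment> \<open>The inclusion already proved makes the situation symmetric in \<open>K\<close>
    and \<open>M\<close>, so it can be applied again with the roles exchanged.\<close>
  have "K \<subseteq> block M"
    using sub[OF K M assms(5)] clique_subset_block[OF K(1)] by blast
  then show ?thesis using sub[OF K M assms(5)] sub[OF M K] by blast
qed

text \<open>Large enough to lose \<open>l^2\<close> intersections with other blocks and still permit
  a greedy choice of one vertex per block, and to leave a class of size
  \<open>block_threshold\<close> when all but \<open>4 * l^2\<close> vertices are distributed among
  \<open>l^2\<close> blocks.\<close>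

definition block_clique_size :: nat where
  "block_clique_size = (l\<^sup>2 + 1) * (block_threshold + 4 * l\<^sup>2) + 1"

lemma block_threshold_le_size: "block_threshold \<le> block_clique_size"
  by (simp add: block_clique_size_def algebra_simps)

text \<open>From \<open>l^2 + 1\<close> distinct blocks one could choose pairwise nonadjacent
  vertices, one in each representing clique: a forbidden claw centred at \<open>y\<close>.\<close>

lemma card_blocks_in_neighbourhood:
  assumes \<K>: "\<And>K. K \<in> \<K> \<Longrightarrow> is_clique K \<and> card K = block_clique_size \<and> K \<subseteq> nb y"
    and fin: "finite \<K>"
  shows "card (block ` \<K>) \<le> l\<^sup>2"
proof (rule ccontr)
  assume "\<not> ?thesis"
  then have "l\<^sup>2 + 1 \<le> card (block ` \<K>)" by simp
  then obtain \<B> where \<B>: "\<B> \<subseteq> block ` \<K>" "card \<B> = l\<^sup>2 + 1"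
    by (rule obtain_subset_with_card_n)
  have fin\<B>: "finite \<B>" using \<B> fin finite_subset by blast
  from \<B>(1) have "\<forall>B\<in>\<B>. \<exists>K. K \<in> \<K> \<and> block K = B" by auto
  then obtain rep where rep: "\<And>B. B \<in> \<B> \<Longrightarrow> rep B \<in> \<K> \<and> block (rep B) = B" by metis
  \<comment> \<open>The part of the representing clique that belongs to no other chosen
    block.\<close>
  define A where "A B = rep B - (\<Union>B'\<in>\<B> - {B}. B')" for B
  have cl: "is_clique (rep B)" "card (rep B) = block_clique_size" "rep B \<subseteq> nb y" "rep B \<subseteq> V"
    if "B \<in> \<B>" for B
    using \<K> rep that by (auto simp: is_clique_def)
  have finrep: "finite (rep B)" if "B \<in> \<B>" for B using cl(1)[OF that] by (rule is_clique_finite)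
  \<comment> \<open>A larger intersection would be a clique that determines both blocks by
    \<open>block_eq\<close>, so they would coincide.\<close>
  have small: "card (rep B \<inter> B') \<le> block_threshold" if "B \<in> \<B>" "B' \<in> \<B>" "B \<noteq> B'" for B B'
  proof (rule ccontr)
    assume "\<not> ?thesis"
    then have large: "block_threshold \<le> card (rep B \<inter> B')" by simp
    have clq: "is_clique (rep B \<inter> B')" using cl(1)[OF that(1)] is_clique_subset by blast
    have "block (rep B \<inter> B') = block (rep B)"
      using cl[OF that(1)] block_threshold_le_size large clq clique_subset_block[of "rep B"]
      by (intro block_eq) auto
    moreover have "block (rep B \<inter> B') = block (rep B')"
      using cl[OF that(2)] block_threshold_le_size large clq rep[OF that(2)]
      by (intro block_eq) auto
    ultimately show False using rep that by auto
  qed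
  have large: "1 + card \<B> * (1 * (2 * l\<^sup>2)) \<le> card (A B)" if "B \<in> \<B>" for B
  proof -
    have "card (rep B) \<le> card (A B \<union> (\<Union>B'\<in>\<B> - {B}. rep B \<inter> B'))"
      using finrep that fin\<B> by (intro card_mono) (auto simp: A_def)
    also have "\<dots> \<le> card (A B) + card (\<Union>B'\<in>\<B> - {B}. rep B \<inter> B')"
      by (rule card_Un_le)
    also have "card (\<Union>B'\<in>\<B> - {B}. rep B \<inter> B') \<le> (\<Sum>B'\<in>\<B> - {B}. card (rep B \<inter> B'))"
      using fin\<B> by (intro card_UN_le) auto
    also have "\<dots> \<le> (\<Sum>B'\<in>\<B> - {B}. block_threshold)"
      using small that by (intro sum_mono) auto
    also have "\<dots> = l\<^sup>2 * block_threshold"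
      using that fin\<B> \<B>(2) by simp
    finally show ?thesis
      using cl(2)[OF that] \<B>(2) by (simp add: block_clique_size_def algebra_simps)
  qed
  have sep: "card (A B' \<inter> nb a) \<le> 2 * l\<^sup>2" if "B \<in> \<B>" "B' \<in> \<B>" "B \<noteq> B'" "a \<in> A B" for B B' a
  proof -
    have "a \<in> V" "a \<notin> block (rep B')" using that cl(4) rep by (auto simp: A_def)
    then have "card (rep B' \<inter> nb a) < 2 * l\<^sup>2" using not_in_block cl(1) that by blast
    moreover have "card (A B' \<inter> nb a) \<le> card (rep B' \<inter> nb a)"
      using finrep that by (intro card_mono) (auto simp: A_def)
    ultimately show ?thesis by simp
  qed
  have "\<exists>T. (\<forall>B\<in>\<B>. T B \<subseteq> A B \<and> card (T B) = 1) \<and>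
    (\<forall>B\<in>\<B>. \<forall>B'\<in>\<B>. B \<noteq> B' \<longrightarrow> (\<forall>x\<in>T B. \<forall>y\<in>T B'. \<not> E x y))"
  proof (rule separated_subsets[where d = "2 * l\<^sup>2"])
    show "finite (A B)" if "B \<in> \<B>" for B using finrep[OF that] by (simp add: A_def)
  qed (fact fin\<B> large sep)+
  then obtain T where T0: "\<forall>B\<in>\<B>. T B \<subseteq> A B \<and> card (T B) = 1"
    and indep: "\<forall>B\<in>\<B>. \<forall>B'\<in>\<B>. B \<noteq> B' \<longrightarrow> (\<forall>x\<in>T B. \<forall>y\<in>T B'. \<not> E x y)"
    by (elim exE conjE)
  have T: "T B \<subseteq> A B" "card (T B) = 1" if "B \<in> \<B>" for B using T0 that by auto
  define g where "g B = the_elem (T B)" for B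
  have g: "T B = {g B}" if "B \<in> \<B>" for B
    using T(2)[OF that] unfolding g_def by (metis card_1_singletonE the_elem_eq)
  have g_in: "g B \<in> rep B" "B' \<in> \<B> \<Longrightarrow> B' \<noteq> B \<Longrightarrow> g B \<notin> B'" if "B \<in> \<B>" for B B'
    using g[OF that] T(1)[OF that] that by (auto simp: A_def)
  have g_own: "g B \<in> B" if "B \<in> \<B>" for B
    using g_in(1)[OF that] clique_subset_block[OF cl(1)[OF that]] rep[OF that] by auto
  have "inj_on g \<B>"
    using g_in(2) g_own by (metis inj_onI)
  then have "card (g ` \<B>) = l\<^sup>2 + 1" using \<B>(2) by (simp add: card_image)
  moreover have "card (g ` \<B>) \<le> l\<^sup>2"
  proof (rule no_large_claw[of _ y])
    show "g ` \<B> \<subseteq> nb y" using g_in(1) cl(3) by auto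
    fix u w assume "u \<in> g ` \<B>" "w \<in> g ` \<B>"
    then obtain B B' where B: "B \<in> \<B>" "B' \<in> \<B>" "u = g B" "w = g B'" by blast
    show "\<not> E u w"
    proof (cases "B = B'")
      case True
      then show ?thesis using B edge_irrefl by simp
    next
      case False
      with indep B(1,2) have "\<forall>x\<in>T B. \<forall>y\<in>T B'. \<not> E x y" by simp
      then show ?thesis using g[OF B(1)] g[OF B(2)] B(3,4) by simp
    qed
  qed
  ultimately show False by simp
qed

text \<open>By connectivity some edge \<open>x y\<close> leaves the block. Most of \<open>K\<close>
  is at distance 2 from \<open>y\<close>, so most \<open>z\<close> in \<open>K\<close> share with
  \<open>y\<close> a clique of common neighbours. Many of these cliques have the same block, which
  contains \<open>y\<close> and a large part of \<open>K\<close>; so it is \<open>block K\<close>, a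
  contradiction.\<close>

lemma block_is_everything:
  assumes conn: "\<And>x y. x \<in> V \<Longrightarrow> y \<in> V \<Longrightarrow> E\<^sup>*\<^sup>* x y"
    and common: "\<And>x y z. E x z \<Longrightarrow> E z y \<Longrightarrow> x \<noteq> y \<Longrightarrow> \<not> E x y \<Longrightarrow>
      ramsey_bound block_clique_size (l\<^sup>2 + 1) \<le> card (nb x \<inter> nb y)"
    and K: "is_clique K" "card K = block_clique_size"
  shows "block K = V"
proof (rule ccontr)
  assume "block K \<noteq> V"
  then obtain y0 where y0: "y0 \<in> V" "y0 \<notin> block K" using block_subset_V by blast
  have "K \<noteq> {}" using K(2) by (auto simp: block_clique_size_def)
  then obtain x0 where "x0 \<in> block K" using clique_subset_block[OF K(1)] by auto
  have "E\<^sup>*\<^sup>* x0 y0" using conn y0 \<open>x0 \<in> block K\<close> block_subset_V by blast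
  then have "\<exists>x y. x \<in> block K \<and> y \<notin> block K \<and> E x y"
    using \<open>x0 \<in> block K\<close> y0(2) by (induction rule: converse_rtranclp_induct) auto
  then obtain x y where x: "x \<in> block K" and y: "y \<notin> block K" and xy: "E x y" by blast
  have "y \<in> V" using xy edge_in_V by blast
  \<comment> \<open>These vertices are joined to \<open>y\<close> through \<open>x\<close> but not
    adjacent to \<open>y\<close>; at most \<open>4 * l^2\<close> vertices of \<open>K\<close> are
    lost.\<close>
  define Z where "Z = K \<inter> nb x - nb y - {y}"
  have fK: "finite K" using K(1) by (rule is_clique_finite)
  have "y \<notin> K" using y clique_subset_block[OF K(1)] by blast
  have "card K \<le> card (Z \<union> (K - nb x) \<union> (K \<inter> nb y))"
    using fK \<open>y \<notin> K\<close> by (intro card_mono) (auto simp: Z_def)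
  also have "\<dots> \<le> card Z + card (K - nb x) + card (K \<inter> nb y)"
    by (meson add_mono card_Un_le order_trans order_refl)
  also have "card (K - nb x) \<le> 2 * l\<^sup>2" using x by (simp add: block_def)
  also have "card (K \<inter> nb y) \<le> 2 * l\<^sup>2"
    using not_in_block[OF K(1) \<open>y \<in> V\<close> y] by simp
  finally have cardZ: "block_clique_size \<le> card Z + 4 * l\<^sup>2" using K(2) by simp
  have "\<exists>M. M \<subseteq> nb y \<inter> nb z \<and> is_clique M \<and> card M = block_clique_size" if "z \<in> Z" for z
  proof -
    have "ramsey_bound block_clique_size (l\<^sup>2 + 1) \<le> card (nb y \<inter> nb z)"
      using that xy edge_sym by (intro common[of y x z]) (auto simp: Z_def)
    moreover have "nb y \<inter> nb z \<subseteq> V" using nb_subset_V by blast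
    ultimately show ?thesis using ramsey_clique[of "nb y \<inter> nb z" block_clique_size] by blast
  qed
  then obtain M where M: "\<And>z. z \<in> Z \<Longrightarrow> M z \<subseteq> nb y \<inter> nb z \<and> is_clique (M z) \<and> card (M z) = block_clique_size"
    by metis
  have finZ: "finite Z" using fK by (simp add: Z_def)
  have "card (block ` M ` Z) \<le> l\<^sup>2"
    using M finZ by (intro card_blocks_in_neighbourhood[of _ y]) auto
  then have "card ((\<lambda>z. block (M z)) ` Z) \<le> l\<^sup>2" by (simp add: image_image)
  \<comment> \<open>Pigeonhole: the cliques \<open>M z\<close> lie in the neighbourhood of
    \<open>y\<close> and so give at most \<open>l^2\<close> blocks.\<close>
  have "\<exists>B. block_threshold \<le> card {z \<in> Z. block (M z) = B}"
  proof (rule ccontr)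
    assume "\<not> ?thesis"
    then have le: "card {z \<in> Z. block (M z) = B} \<le> block_threshold" for B
      by (meson nle_le)
    have "card Z = (\<Sum>B\<in>(\<lambda>z. block (M z)) ` Z. card {z \<in> Z. block (M z) = B})"
      using finZ by (subst card_eq_sum, subst sum.image_gen[of Z _ "\<lambda>z. block (M z)"]) auto
    also have "\<dots> \<le> (\<Sum>B\<in>(\<lambda>z. block (M z)) ` Z. block_threshold)"
      by (intro sum_mono le)
    also have "\<dots> \<le> l\<^sup>2 * block_threshold"
      using \<open>card ((\<lambda>z. block (M z)) ` Z) \<le> l\<^sup>2\<close> by simp
    finally show False using cardZ by (simp add: block_clique_size_def algebra_simps)
  qed
  then obtain B where B: "block_threshold \<le> card {z \<in> Z. block (M z) = B}" ..
  define F where "F = {z \<in> Z. block (M z) = B}"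
  have F: "block_threshold \<le> card F" using B by (simp add: F_def)
  have "block_threshold > 0" by (simp add: block_threshold_def)
  with F have "F \<noteq> {}" by (metis card.empty not_le)
  then obtain z where z: "z \<in> Z" "block (M z) = B" by (auto simp: F_def)
  have subM: "u \<in> block (M u)" if "u \<in> Z" for u
  proof -
    have "M u - nb u = {}" using M[OF that] by auto
    moreover have "u \<in> V" using that K(1) by (auto simp: Z_def is_clique_def)
    ultimately show ?thesis using two_le_l by (simp only: block_def mem_Collect_eq card.empty) simp
  qed
  have clF: "is_clique F" by (rule is_clique_subset[OF K(1)]) (auto simp: F_def Z_def)
  \<comment> \<open>The clique \<open>F\<close> lies in both blocks and is large enough for
    \<open>block_eq\<close> to identify them.\<close>
  have "F \<subseteq> block (M z)" using subM z(2) by (auto simp: F_def)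
  then have "block F = block (M z)"
    using M[OF z(1)] block_threshold_le_size clF F by (intro block_eq) auto
  moreover have "F \<subseteq> block K" using clique_subset_block[OF K(1)] by (auto simp: F_def Z_def)
  then have "block F = block K"
    using K block_threshold_le_size clF F by (intro block_eq) auto
  moreover have "y \<in> block (M z)"
  proof -
    have "M z - nb y = {}" using M[OF z(1)] by auto
    then show ?thesis using \<open>y \<in> V\<close> two_le_l by (simp only: block_def mem_Collect_eq card.empty) simp
  qed
  ultimately show False using y by simp
qed

lemma card_V_if_many_common_neighbours:
  assumes conn: "\<And>x y. x \<in> V \<Longrightarrow> y \<in> V \<Longrightarrow> E\<^sup>*\<^sup>* x y"
    and common: "\<And>x y z. E x z \<Longrightarrow> E z y \<Longrightarrow> x \<noteq> y \<Longrightarrow> \<not> E x y \<Longrightarrow>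
      ramsey_bound block_clique_size (l\<^sup>2 + 1) \<le> card (nb x \<inter> nb y)"
    and "x \<in> V" and deg: "\<And>x. x \<in> V \<Longrightarrow> card (nb x) = k"
    and large: "ramsey_bound block_clique_size (l\<^sup>2 + 1) \<le> k"
  shows "card V < k + nonneighbour_bound"
proof -
  obtain K where K: "is_clique K" "card K = block_clique_size"
  proof (rule ramsey_clique)
    show "nb x \<subseteq> V" by (rule nb_subset_V)
    show "ramsey_bound block_clique_size (l\<^sup>2 + 1) \<le> card (nb x)"
      using deg[OF \<open>x \<in> V\<close>] large by simp
  qed blast+
  have V: "block K = V" using conn common K by (rule block_is_everything)
  have "V \<subseteq> (block K - nb x) \<union> nb x" using V by auto
  then have "card V \<le> card ((block K - nb x) \<union> nb x)"
    using finite_block by (intro card_mono) auto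
  also have "\<dots> \<le> card (block K - nb x) + card (nb x)" by (rule card_Un_le)
  also have "card (block K - nb x) < nonneighbour_bound"
    using K block_threshold_le_size V \<open>x \<in> V\<close> by (intro card_block_nonneighbours) auto
  finally show ?thesis using deg[OF \<open>x \<in> V\<close>] by simp
qed

end

section \<open>Maximal cliques: few common neighbours\<close>

context form_bounded_graph
begin

definition maximal_clique :: "nat set \<Rightarrow> bool" where
  "maximal_clique Q \<longleftrightarrow> is_clique Q \<and> (\<forall>x\<in>V - Q. \<exists>q\<in>Q. \<not> E x q)"

lemma maximal_clique_finite: "maximal_clique Q \<Longrightarrow> finite Q"
  using is_clique_finite by (simp add: maximal_clique_def)

lemma is_clique_extend:
  assumes "is_clique K"
  obtains Q where "K \<subseteq> Q" "maximal_clique Q"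
proof -
  have "finite {Q. is_clique Q}"
    by (rule finite_subset[of _ "Pow V"]) (auto simp: is_clique_def finite_V)
  from finite_has_maximal2[OF this, of K] assms obtain Q where
    Q: "is_clique Q" "K \<subseteq> Q" "\<And>Q'. is_clique Q' \<Longrightarrow> Q \<subseteq> Q' \<Longrightarrow> Q = Q'"
    by auto
  have "\<exists>q\<in>Q. \<not> E x q" if "x \<in> V - Q" for x
  proof (rule ccontr)
    assume "\<not> ?thesis"
    then have "is_clique (insert x Q)"
      using Q(1) that edge_sym by (auto simp: is_clique_def)
    from Q(3)[OF this] that show False by blast
  qed
  with Q that show ?thesis by (auto simp: maximal_clique_def)
qed

text \<open>The first summand serves the sharp bound for vertices outside the clique. The multiples
  of \<open>D\<close> absorb intersections with other cliques and neighbourhoods, and the terms with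
  \<open>l ^ 3\<close> allow the choice of \<open>l ^ 3\<close> separated vertices from each of
  \<open>l\<close> cliques.\<close>

definition clique_threshold :: "nat \<Rightarrow> nat" where
  "clique_threshold D = 2 * (l * (l - 1) + 1)\<^sup>2 + 2 + (l + 2) * D + l ^ 3 + l * (l ^ 3 * D)"

definition large_clique :: "nat \<Rightarrow> nat \<Rightarrow> nat set \<Rightarrow> bool" where
  "large_clique D x Q \<longleftrightarrow> maximal_clique Q \<and> x \<in> Q \<and> clique_threshold D \<le> card Q"

definition uncovered :: "nat \<Rightarrow> nat \<Rightarrow> nat set" where
  "uncovered D x = {w \<in> nb x. \<forall>Q. large_clique D x Q \<longrightarrow> w \<notin> Q}"

text \<open>Too many uncovered neighbours would contain a clique of size
  \<open>clique_threshold D\<close>; adding \<open>x\<close> and extending gives a large clique at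
  \<open>x\<close> that covers them.\<close>

lemma card_uncovered_less:
  assumes "x \<in> V"
  shows "card (uncovered D x) < ramsey_bound (clique_threshold D) (l\<^sup>2 + 1)"
proof (rule ccontr)
  assume "\<not> ?thesis"
  then have large: "ramsey_bound (clique_threshold D) (l\<^sup>2 + 1) \<le> card (uncovered D x)" by simp
  have sub: "uncovered D x \<subseteq> nb x" by (auto simp: uncovered_def)
  obtain K where K: "K \<subseteq> uncovered D x" "is_clique K" "card K = clique_threshold D"
  proof (rule ramsey_clique[OF _ large])
    show "uncovered D x \<subseteq> V" using sub nb_subset_V by blast
    show "\<exists>y. T \<subseteq> nb y" if "T \<subseteq> uncovered D x" for T using that sub by blast
  qed
  have "is_clique (insert x K)"
    using K sub assms edge_sym by (auto simp: is_clique_def)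
  then obtain Q where Q: "insert x K \<subseteq> Q" "maximal_clique Q" by (rule is_clique_extend)
  have "card K \<le> card Q" using Q maximal_clique_finite by (intro card_mono) auto
  then have lc: "large_clique D x Q" using Q K(3) by (simp add: large_clique_def)
  have "0 < card K" using K(3) by (simp add: clique_threshold_def)
  then obtain w where "w \<in> K" by (metis card_gt_0_iff ex_in_conv)
  then have "w \<in> Q" "w \<in> uncovered D x" using Q(1) K(1) by blast+
  then show False using lc by (simp add: uncovered_def)
qed

section \<open>Graphs with at most \<open>D\<close> common neighbours at distance 2\<close>

context
  fixes D :: nat
  assumes few_common: "\<And>x y z. E x z \<Longrightarrow> E z y \<Longrightarrow> x \<noteq> y \<Longrightarrow> \<not> E x y \<Longrightarrow> card (nb x \<inter> nb y) \<le> D"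
begin

text \<open>By maximality \<open>x\<close> misses some \<open>q\<close> in \<open>Q\<close>; the
  neighbours of \<open>x\<close> in \<open>Q\<close> are then common neighbours of \<open>x\<close>
  and \<open>q\<close>.\<close>

lemma card_outside_nb:
  assumes Q: "maximal_clique Q" and x: "x \<in> V" "x \<notin> Q"
  shows "card (Q \<inter> nb x) \<le> D"
proof (cases "Q \<inter> nb x = {}")
  case False
  then obtain z where z: "z \<in> Q" "E x z" by auto
  obtain q where q: "q \<in> Q" "\<not> E x q" using Q x by (auto simp: maximal_clique_def)
  have cl: "is_clique Q" using Q by (simp add: maximal_clique_def)
  have "E z q" using z q cl by (metis is_clique_def)
  then have "card (nb x \<inter> nb q) \<le> D" using few_common[OF z(2)] q x by blast
  moreover have "card (Q \<inter> nb x) \<le> card (nb x \<inter> nb q)"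
    using q cl by (intro card_mono) (force simp: is_clique_def)+
  ultimately show ?thesis by simp
qed simp

text \<open>The crude bound \<open>D\<close> leaves enough non-neighbours in \<open>Q\<close> for
  the form argument, which replaces it by a bound free of \<open>D\<close>.\<close>

lemma card_outside_large_clique:
  assumes Q: "large_clique D z Q" and x: "x \<in> V" "x \<notin> Q"
  shows "card (Q \<inter> nb x) \<le> l * (l - 1)"
proof (rule card_clique_Int_nb_le)
  have m: "maximal_clique Q" using Q by (simp add: large_clique_def)
  then show "is_clique Q" by (simp add: maximal_clique_def)
  have "card Q = card (Q \<inter> nb x) + card (Q - nb x)"
    using card_Int_Diff maximal_clique_finite[OF m] .
  then show "2 * (l * (l - 1) + 1)\<^sup>2 < card (Q - nb x)"
    using card_outside_nb[OF m x] Q by (simp add: large_clique_def clique_threshold_def algebra_simps)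
qed (use x in auto)

text \<open>A vertex of \<open>Q'\<close> outside \<open>Q\<close> is adjacent to the whole
  intersection.\<close>

lemma card_Int_maximal_cliques:
  assumes "maximal_clique Q" "maximal_clique Q'" "Q \<noteq> Q'"
  shows "card (Q \<inter> Q') \<le> D"
proof -
  have "\<not> Q' \<subseteq> Q"
  proof
    assume "Q' \<subseteq> Q"
    then obtain x where x: "x \<in> Q" "x \<notin> Q'" using assms(3) by blast
    moreover have "x \<in> V" using assms(1) x by (auto simp: maximal_clique_def is_clique_def)
    ultimately obtain q where "q \<in> Q'" "\<not> E x q" using assms(2) by (auto simp: maximal_clique_def)
    then show False using assms(1) x \<open>Q' \<subseteq> Q\<close> by (metis is_clique_def maximal_clique_def subsetD)
  qed
  then obtain q where q: "q \<in> Q'" "q \<notin> Q" by blast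
  then have "Q \<inter> Q' \<subseteq> Q \<inter> nb q" "q \<in> V"
    using assms(2) by (force simp: maximal_clique_def is_clique_def)+
  then have "card (Q \<inter> Q') \<le> card (Q \<inter> nb q)"
    using maximal_clique_finite[OF assms(1)] by (intro card_mono) auto
  also have "\<dots> \<le> D" using assms(1) \<open>q \<in> V\<close> q(2) by (rule card_outside_nb)
  finally show ?thesis .
qed

text \<open>Suppose \<open>u\<close> is missed. Choose \<open>t\<close> vertices from each of the
  \<open>l\<close> cliques, with no edges between different cliques or to \<open>u\<close>, and give
  weight \<open>t\<close> to \<open>x\<close>, -1 to the chosen vertices and \<open>-(l^2)\<close>
  to \<open>u\<close>. Because there are exactly \<open>l\<close> cliques the terms in t^2 cancel,
  leaving l(l - 1)t from \<open>x\<close> and the cliques and l^5 - 2 l^2 t from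
  \<open>u\<close>.\<close>

lemma large_cliques_cover_neighbourhood:
  assumes \<Q>: "\<And>Q. Q \<in> \<Q> \<Longrightarrow> large_clique D x Q" and card: "card \<Q> = l" and u: "E x u"
  shows "u \<in> \<Union>\<Q>"
proof (rule ccontr)
  assume not_covered: "u \<notin> \<Union>\<Q>"
  \<comment> \<open>For this \<open>t\<close> the form has the value
    \<open>-(l ^ 4)\<close>.\<close>
  define t where "t = l ^ 3"
  have fin: "finite \<Q>" using card two_le_l by (metis card.infinite not_numeral_le_zero)
  have m: "maximal_clique Q" "is_clique Q" "finite Q" "x \<in> Q" "Q \<subseteq> V" if "Q \<in> \<Q>" for Q
    using \<Q>[OF that] maximal_clique_finite by (auto simp: large_clique_def maximal_clique_def is_clique_def)
  have V: "x \<in> V" "u \<in> V" using u edge_in_V by blast+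
  define A where "A Q = Q - (insert x (nb u) \<union> \<Union>(\<Q> - {Q}))" for Q
  have "\<exists>T. (\<forall>Q\<in>\<Q>. T Q \<subseteq> A Q \<and> card (T Q) = t) \<and>
    (\<forall>Q\<in>\<Q>. \<forall>Q'\<in>\<Q>. Q \<noteq> Q' \<longrightarrow> (\<forall>x\<in>T Q. \<forall>y\<in>T Q'. \<not> E x y))"
  proof (rule separated_subsets[where d = D])
    show "finite (A Q)" if "Q \<in> \<Q>" for Q using m(3)[OF that] by (simp add: A_def)
    show "t + card \<Q> * (t * D) \<le> card (A Q)" if Q: "Q \<in> \<Q>" for Q
    proof -
      have "card Q \<le> card (A Q \<union> ({x} \<union> ((Q \<inter> nb u) \<union> (\<Union>Q'\<in>\<Q> - {Q}. Q \<inter> Q'))))"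
        using m(3)[OF Q] fin by (intro card_mono) (auto simp: A_def)
      also have "\<dots> \<le> card (A Q) + (card {x} + (card (Q \<inter> nb u) + card (\<Union>Q'\<in>\<Q> - {Q}. Q \<inter> Q')))"
        by (intro order_trans[OF card_Un_le] add_left_mono order_refl)
      also have "card (Q \<inter> nb u) \<le> D"
        using m(1)[OF Q] V(2) not_covered Q by (intro card_outside_nb) auto
      also have "card (\<Union>Q'\<in>\<Q> - {Q}. Q \<inter> Q') \<le> (\<Sum>Q'\<in>\<Q> - {Q}. card (Q \<inter> Q'))"
        using fin by (intro card_UN_le) auto
      also have "\<dots> \<le> (\<Sum>Q'\<in>\<Q> - {Q}. D)"
        using m(1) Q by (intro sum_mono card_Int_maximal_cliques) auto
      also have "\<dots> \<le> l * D"
        using card Q fin by simp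
      finally have "card Q \<le> card (A Q) + (1 + (D + l * D))" by simp
      then show ?thesis
        using \<Q>[OF Q] card by (simp add: large_clique_def clique_threshold_def t_def algebra_simps)
    qed
    show "card (A Q' \<inter> nb a) \<le> D" if "Q \<in> \<Q>" "Q' \<in> \<Q>" "Q \<noteq> Q'" "a \<in> A Q" for Q Q' a
    proof -
      have "a \<in> V" "a \<notin> Q'" using that m(5)[OF that(1)] by (auto simp: A_def)
      then have "card (Q' \<inter> nb a) \<le> D" using card_outside_nb m(1)[OF that(2)] by blast
      moreover have "card (A Q' \<inter> nb a) \<le> card (Q' \<inter> nb a)"
        using m(3)[OF that(2)] by (intro card_mono) (auto simp: A_def)
      ultimately show ?thesis by simp
    qed
  qed (fact fin)
  then obtain T where T0: "\<forall>Q\<in>\<Q>. T Q \<subseteq> A Q \<and> card (T Q) = t"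
    and indep: "\<forall>Q\<in>\<Q>. \<forall>Q'\<in>\<Q>. Q \<noteq> Q' \<longrightarrow> (\<forall>x\<in>T Q. \<forall>y\<in>T Q'. \<not> E x y)"
    by (elim exE conjE)
  have T: "T Q \<subseteq> A Q" "card (T Q) = t" "T Q \<subseteq> Q" "finite (T Q)" if "Q \<in> \<Q>" for Q
    using T0 that m(3)[OF that] by (auto simp: A_def intro: finite_subset)
  define B where "B = (\<Union>Q\<in>\<Q>. T Q)"
  have disj: "T Q \<inter> T Q' = {}" if "Q \<in> \<Q>" "Q' \<in> \<Q>" "Q \<noteq> Q'" for Q Q'
    using T(1)[OF that(1)] T(3)[OF that(2)] that by (auto simp: A_def)
  have cardB: "card B = l * t"
    unfolding B_def using fin T(2,4) disj card by (subst card_UN_disjoint) auto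
  have finB: "finite B" using fin T(4) by (auto simp: B_def)
  \<comment> \<open>The chosen set induces a disjoint union of \<open>l\<close> cliques of size
    \<open>t\<close>.\<close>
  have "(\<Sum>j\<in>B. adj E i j) = real t - 1" if "i \<in> B" for i
  proof -
    obtain Q where Q: "Q \<in> \<Q>" "i \<in> T Q" using \<open>i \<in> B\<close> by (auto simp: B_def)
    have "E i j \<longleftrightarrow> j \<in> T Q - {i}" if "j \<in> B" for j
    proof -
      obtain Q' where Q': "Q' \<in> \<Q>" "j \<in> T Q'" using \<open>j \<in> B\<close> by (auto simp: B_def)
      show ?thesis
      proof (cases "Q = Q'")
        case True
        have "i \<in> Q" "j \<in> Q" using T(3) Q Q' True by auto
        then show ?thesis using True Q' edge_irrefl m(2)[OF Q(1)] by (auto simp: is_clique_def)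
      next
        case False
        then show ?thesis using indep Q Q' disj[OF Q(1) Q'(1)] by auto
      qed
    qed
    then have "(\<Sum>j\<in>B. adj E i j) = (\<Sum>j\<in>B. if j \<in> T Q - {i} then 1 else 0)"
      by (intro sum.cong) (auto simp: adj_def)
    also have "\<dots> = real (card (B \<inter> (T Q - {i})))"
      using sum.inter_restrict[OF finB, of "\<lambda>_. 1 :: real" "T Q - {i}"] by simp
    also have "B \<inter> (T Q - {i}) = T Q - {i}" using Q(1) by (auto simp: B_def)
    also have "real (card (T Q - {i})) = real t - 1"
    proof -
      have "card (T Q) = Suc (card (T Q - {i}))"
        using T(4)[OF Q(1)] Q(2) by (rule card.remove)
      then show ?thesis using T(2)[OF Q(1)] by simp
    qed
    finally show ?thesis .
  qed
  then have eBB: "edges_between B B = real l * t * (real t - 1)"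
    by (simp add: edges_between_def cardB)
  have BV: "B \<subseteq> V" "x \<notin> B" "u \<notin> B" "x \<noteq> u"
    using T(1,3) m(5) not_covered u edge_irrefl unfolding B_def A_def by blast+
  have exB: "edges_between {x} B = real l * t"
  proof (subst edges_between_complete)
    show "E y b" if "y \<in> {x}" "b \<in> B" for y b
    proof -
      obtain Q where Q: "Q \<in> \<Q>" "b \<in> T Q" using \<open>b \<in> B\<close> by (auto simp: B_def)
      then have "b \<in> Q" "b \<noteq> x" using T(1)[OF Q(1)] by (auto simp: A_def)
      then show ?thesis using m(2,4)[OF Q(1)] that(1) by (auto simp: is_clique_def)
    qed
  qed (simp add: cardB)
  have eBu: "edges_between B {u} = 0"
  proof (rule edges_between_none)
    show "\<not> E b y" if "b \<in> B" "y \<in> {u}" for b y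
    proof -
      obtain Q where "Q \<in> \<Q>" "b \<in> T Q" using \<open>b \<in> B\<close> by (auto simp: B_def)
      then have "b \<notin> nb u" using T(1) unfolding A_def by blast
      then show ?thesis using \<open>y \<in> {u}\<close> edge_sym by auto
    qed
  qed
  have e0: "edges_between {y} {y} = 0" for y by (intro edges_between_none) (auto simp: edge_irrefl)
  have exu: "edges_between {x} {u} = 1" using u by (subst edges_between_complete) auto
  have "0 \<le> real l * t * (real t - 1) - 2 * real t * (real l * t) - 2 * real t * (real l)\<^sup>2
      + real l * ((real t)\<^sup>2 + real l * t + ((real l)\<^sup>2)\<^sup>2)"
    using three_part_form[of "{x}" B "{u}" "real t" "-1" "- ((real l)\<^sup>2)"] BV V
    by (simp add: e0 eBB exB eBu exu cardB)
  also have "\<dots> = - (real l ^ 4)"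
    unfolding t_def by (simp add: algebra_simps power2_eq_square power3_eq_cube power4_eq_xxxx)
  also have "\<dots> < 0" using two_le_l by simp
  finally show False by simp
qed

lemma finite_large_cliques: "finite {Q. large_clique D x Q}"
  by (rule finite_subset[of _ "Pow V"])
    (auto simp: large_clique_def maximal_clique_def is_clique_def finite_V)

text \<open>With \<open>l + 1\<close> large cliques at \<open>x\<close>, any \<open>l\<close> of
  them would cover the neighbours of \<open>x\<close> in the remaining one, yet they meet it in at
  most \<open>l * D\<close> vertices.\<close>

lemma card_large_cliques_le: "card {Q. large_clique D x Q} \<le> l"
proof (rule ccontr)
  assume "\<not> ?thesis"
  then have "l + 1 \<le> card {Q. large_clique D x Q}" by simp
  then obtain \<Q>' where Q': "\<Q>' \<subseteq> {Q. large_clique D x Q}" "card \<Q>' = l + 1"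
    by (rule obtain_subset_with_card_n)
  then have "\<Q>' \<noteq> {}" by auto
  then obtain Q where Q: "Q \<in> \<Q>'" by blast
  define \<Q> where "\<Q> = \<Q>' - {Q}"
  have fin: "finite \<Q>'" using Q'(2) by (metis Suc_eq_plus1 card.infinite nat.distinct(1))
  have card: "card \<Q> = l" using Q fin Q'(2) by (simp add: \<Q>_def)
  have Qm: "maximal_clique Q" "x \<in> Q" using Q Q'(1) by (auto simp: large_clique_def)
  have "card (\<Union>P\<in>\<Q>. Q \<inter> P) \<le> (\<Sum>P\<in>\<Q>. card (Q \<inter> P))"
    using fin by (intro card_UN_le) (simp add: \<Q>_def)
  also have "\<dots> \<le> (\<Sum>P\<in>\<Q>. D)"
    using Q' Qm by (intro sum_mono card_Int_maximal_cliques) (auto simp: \<Q>_def large_clique_def)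
  also have "\<dots> = l * D" using card by simp
  also have "\<dots> < card Q" using Q Q'(1) by (auto simp: large_clique_def clique_threshold_def algebra_simps)
  finally have "\<not> Q \<subseteq> (\<Union>P\<in>\<Q>. Q \<inter> P)"
    using card_mono[of "\<Union>P\<in>\<Q>. Q \<inter> P" Q] fin maximal_clique_finite[OF Qm(1)]
    by (auto simp: \<Q>_def)
  then obtain u where u: "u \<in> Q" "u \<notin> \<Union>\<Q>" by blast
  have "\<Q> \<noteq> {}" using card two_le_l by auto
  then have "x \<in> \<Union>\<Q>" using Q'(1) by (auto simp: \<Q>_def large_clique_def)
  then have "x \<noteq> u" using u(2) by blast
  then have "E x u" using Qm u(1) by (auto simp: maximal_clique_def is_clique_def)
  with card have "u \<in> \<Union>\<Q>"
    using Q'(1) by (intro large_cliques_cover_neighbourhood[of _ x]) (auto simp: \<Q>_def)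
  with u(2) show False by blast
qed

text \<open>The vertex \<open>y\<close> is taken in \<open>Q\<close> so that no uncovered neighbour
  of \<open>x\<close> outside \<open>Q\<close> is adjacent to it. All common neighbours of
  \<open>x\<close> and \<open>y\<close> then lie in few cliques, each containing at most
  \<open>l * (l - 1)\<close> of them.\<close>

lemma ex_few_common_neighbours:
  assumes Q: "large_clique D z Q"
    and size: "l * (l - 1) * (ramsey_bound (clique_threshold D) (l\<^sup>2 + 1) + 1) < card Q"
    and xz: "E x z" "x \<notin> Q"
  shows "\<exists>y. E z y \<and> x \<noteq> y \<and> \<not> E x y \<and> card (nb x \<inter> nb y) \<le> l\<^sup>2 * (l - 1)"
proof -
  let ?R = "ramsey_bound (clique_threshold D) (l\<^sup>2 + 1)" 
  define b where "b = l * (l - 1)"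
  define \<F> where "\<F> = {Q. large_clique D x Q}"
  have Qm: "maximal_clique Q" "is_clique Q" "finite Q" "z \<in> Q" "Q \<subseteq> V"
    using Q maximal_clique_finite by (auto simp: large_clique_def maximal_clique_def is_clique_def)
  have xV: "x \<in> V" using xz edge_in_V by blast
  \<comment> \<open>The vertices of \<open>Q\<close> to avoid; the hypothesis on the size of
    \<open>Q\<close> says that they do not exhaust it.\<close>
  define X where "X = (Q \<inter> nb x) \<union> (\<Union>w\<in>uncovered D x - Q. Q \<inter> nb w)"
  have unc: "uncovered D x \<subseteq> nb x" by (auto simp: uncovered_def)
  have fu: "finite (uncovered D x)" using finite_subset[OF unc] by simp
  have outside: "card (P \<inter> nb w) \<le> b" if "large_clique D q P" "w \<in> V" "w \<notin> P" for P w q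
    unfolding b_def using that by (rule card_outside_large_clique)
  have "card (\<Union>w\<in>uncovered D x - Q. Q \<inter> nb w) \<le> (\<Sum>w\<in>uncovered D x - Q. card (Q \<inter> nb w))"
    using fu by (intro card_UN_le) simp
  also have "\<dots> \<le> (\<Sum>w\<in>uncovered D x - Q. b)"
    using unc nb_subset_V by (intro sum_mono outside[OF Q]) auto
  also have "\<dots> \<le> ?R * b"
  proof -
    have "card (uncovered D x - Q) \<le> card (uncovered D x)" using fu by (intro card_mono) auto
    also have "\<dots> \<le> ?R" using card_uncovered_less[OF xV] by (rule less_imp_le)
    finally show ?thesis by simp
  qed
  finally have "card (\<Union>w\<in>uncovered D x - Q. Q \<inter> nb w) \<le> ?R * b" .
  then have "card X \<le> b + ?R * b"
    unfolding X_def by (intro order_trans[OF card_Un_le] add_mono outside[OF Q xV xz(2)])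
  also have "\<dots> < card Q" using size unfolding b_def[symmetric] by (simp add: algebra_simps)
  finally have "card X < card Q" .
  moreover have "finite X" using fu Qm(3) by (simp add: X_def)
  ultimately have "\<not> Q \<subseteq> X" using card_mono[of X Q] by auto
  then obtain y where y: "y \<in> Q" "y \<notin> X" by blast
  have nxy: "\<not> E x y" using y by (auto simp: X_def)
  then have "y \<noteq> z" using xz by blast
  then have zy: "E z y" using Qm(2,4) y(1) by (auto simp: is_clique_def)
  have "x \<noteq> y" using xz(2) y(1) by blast
  have yV: "y \<in> V" using y(1) Qm(5) by blast
  have union: "card (\<Union>P\<in>\<F>. P \<inter> nb y) \<le> card \<F> * b"
  proof -
    have "card (\<Union>P\<in>\<F>. P \<inter> nb y) \<le> (\<Sum>P\<in>\<F>. card (P \<inter> nb y))"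
      using finite_large_cliques by (intro card_UN_le) (simp add: \<F>_def)
    also have "\<dots> \<le> (\<Sum>P\<in>\<F>. b)"
    proof (intro sum_mono)
      fix P assume "P \<in> \<F>"
      then have P: "large_clique D x P" by (simp add: \<F>_def)
      have "y \<notin> P"
        using P nxy \<open>x \<noteq> y\<close> by (auto simp: large_clique_def maximal_clique_def is_clique_def)
      with P yV show "card (P \<inter> nb y) \<le> b" by (rule outside)
    qed
    finally show ?thesis by simp
  qed
  have finU: "finite (\<Union>P\<in>\<F>. P \<inter> nb y)"
    using finite_large_cliques by (auto simp: \<F>_def)
  \<comment> \<open>With exactly \<open>l\<close> large cliques at \<open>x\<close> nothing is
    uncovered. With fewer, \<open>Q\<close> takes the place of a missing clique and holds the
    uncovered common neighbours, so \<open>l\<close> cliques suffice in both cases.\<close>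
  have "card (nb x \<inter> nb y) \<le> l * b"
  proof (cases "card \<F> = l")
    case True
    have "nb x \<inter> nb y \<subseteq> (\<Union>P\<in>\<F>. P \<inter> nb y)"
    proof
      fix w assume w: "w \<in> nb x \<inter> nb y"
      then have "w \<in> \<Union>\<F>"
        using True by (intro large_cliques_cover_neighbourhood[of _ x]) (auto simp: \<F>_def)
      then show "w \<in> (\<Union>P\<in>\<F>. P \<inter> nb y)" using w by auto
    qed
    then have "card (nb x \<inter> nb y) \<le> card (\<Union>P\<in>\<F>. P \<inter> nb y)" using finU by (rule card_mono[rotated])
    then show ?thesis using union True by simp
  next
    case False
    then have "Suc (card \<F>) \<le> l" using card_large_cliques_le[of x] by (simp add: \<F>_def)
    have "nb x \<inter> nb y \<subseteq> (\<Union>P\<in>\<F>. P \<inter> nb y) \<union> (Q \<inter> nb x)"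
    proof
      fix w assume w: "w \<in> nb x \<inter> nb y"
      show "w \<in> (\<Union>P\<in>\<F>. P \<inter> nb y) \<union> (Q \<inter> nb x)"
      proof (cases "w \<in> uncovered D x")
        case True
        have "w \<in> Q"
        proof (rule ccontr)
          assume "w \<notin> Q"
          then have "y \<in> X" using True w y(1) edge_sym by (auto simp: X_def)
          then show False using y(2) by blast
        qed
        then show ?thesis using w by blast
      qed (use w in \<open>auto simp: uncovered_def \<F>_def\<close>)
    qed
    then have "card (nb x \<inter> nb y) \<le> card ((\<Union>P\<in>\<F>. P \<inter> nb y) \<union> (Q \<inter> nb x))"
      using finU Qm(3) by (intro card_mono) auto
    also have "\<dots> \<le> card (\<Union>P\<in>\<F>. P \<inter> nb y) + card (Q \<inter> nb x)" by (rule card_Un_le)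
    also have "\<dots> \<le> card \<F> * b + b"
      using union outside[OF Q xV xz(2)] by (rule add_mono)
    also have "\<dots> = Suc (card \<F>) * b" by simp
    also have "\<dots> \<le> l * b" using \<open>Suc (card \<F>) \<le> l\<close> by (rule mult_le_mono1)
    finally show ?thesis .
  qed
  then show ?thesis
    using zy nxy \<open>x \<noteq> y\<close> by (auto simp: b_def power2_eq_square mult.assoc)
qed

end

definition initial_clique_size :: "nat \<Rightarrow> nat" where
  "initial_clique_size D = clique_threshold D
     + l * (l - 1) * (ramsey_bound (clique_threshold D) (l\<^sup>2 + 1) + 1) + 1"

text \<open>Since all pairs at distance 2 have the same number \<open>c\<close> of common
  neighbours, one pair with few suffices. As \<open>V\<close> is larger than a closed neighbourhood,
  \<open>Q\<close> is not all of \<open>V\<close>, and connectivity provides an edge leaving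
  it.\<close>

lemma common_neighbours_le:
  assumes conn: "\<And>x y. x \<in> V \<Longrightarrow> y \<in> V \<Longrightarrow> E\<^sup>*\<^sup>* x y"
    and common: "\<And>x y z. E x z \<Longrightarrow> E z y \<Longrightarrow> x \<noteq> y \<Longrightarrow> \<not> E x y \<Longrightarrow> card (nb x \<inter> nb y) = c"
    and "c \<le> D" and "x \<in> V" and deg: "\<And>x. x \<in> V \<Longrightarrow> card (nb x) = k"
    and large: "ramsey_bound (initial_clique_size D) (l\<^sup>2 + 1) \<le> k"
    and "k + 1 < card V"
  shows "c \<le> l\<^sup>2 * (l - 1)"
proof -
  obtain K where K: "is_clique K" "card K = initial_clique_size D"
  proof (rule ramsey_clique)
    show "nb x \<subseteq> V" by (rule nb_subset_V)
    show "ramsey_bound (initial_clique_size D) (l\<^sup>2 + 1) \<le> card (nb x)"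
      using deg[OF \<open>x \<in> V\<close>] large by simp
  qed blast+
  from K(1) obtain Q where Q: "K \<subseteq> Q" "maximal_clique Q" by (rule is_clique_extend)
  have "card K \<le> card Q" using Q maximal_clique_finite by (intro card_mono) auto
  then have cQ: "initial_clique_size D \<le> card Q" using K by simp
  have QV: "is_clique Q" "Q \<subseteq> V" using Q(2) by (auto simp: maximal_clique_def is_clique_def)
  have "Q \<noteq> {}" using cQ by (auto simp: initial_clique_size_def)
  then obtain q where q: "q \<in> Q" by blast
  have "Q \<noteq> V"
  proof
    assume "Q = V"
    then have "V - {q} \<subseteq> nb q" using QV q by (force simp: is_clique_def)
    then have "card (V - {q}) \<le> k" using card_mono[of "nb q"] deg[of q] QV q by auto
    then show False using \<open>k + 1 < card V\<close> q QV finite_V by (auto simp: card_Diff_singleton_if)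
  qed
  then obtain y where y: "y \<in> V" "y \<notin> Q" using QV by blast
  have "E\<^sup>*\<^sup>* q y" using conn q QV y by blast
  then have "\<exists>z x. z \<in> Q \<and> x \<notin> Q \<and> E z x"
    using q y(2) by (induction rule: converse_rtranclp_induct) auto
  then obtain z w where zw: "z \<in> Q" "w \<notin> Q" "E z w" by blast
  have lc: "large_clique D z Q"
    using Q zw cQ by (auto simp: large_clique_def initial_clique_size_def)
  have few: "card (nb x \<inter> nb y) \<le> D" if "E x z" "E z y" "x \<noteq> y" "\<not> E x y" for x y z
    using common[OF that] \<open>c \<le> D\<close> by simp
  have "l * (l - 1) * (ramsey_bound (clique_threshold D) (l\<^sup>2 + 1) + 1) < card Q"
    using cQ unfolding initial_clique_size_def by linarith
  with few lc have "\<exists>y. E z y \<and> w \<noteq> y \<and> \<not> E w y \<and> card (nb w \<inter> nb y) \<le> l\<^sup>2 * (l - 1)"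
    using edge_sym[OF zw(3)] zw(2) by (rule ex_few_common_neighbours)
  then obtain y where y: "E z y" "w \<noteq> y" "\<not> E w y" "card (nb w \<inter> nb y) \<le> l\<^sup>2 * (l - 1)"
    by blast
  then show ?thesis using common[OF edge_sym[OF zw(3)] y(1,2,3)] by simp
qed

end

section \<open>The Alon--Boppana bound\<close>

locale regular_graph =
  fixes V :: "'a set" and H :: "'a \<Rightarrow> 'a \<Rightarrow> bool" and d :: nat
  assumes finite_V: "finite V"
    and edge_in_V: "H x y \<Longrightarrow> x \<in> V \<and> y \<in> V"
    and edge_sym: "H x y \<Longrightarrow> H y x"
    and degree: "x \<in> V \<Longrightarrow> card {y. H x y} = d"
begin

section \<open>Balls and distance levels\<close>

primrec gball :: "'a \<Rightarrow> nat \<Rightarrow> 'a set" where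
  "gball x 0 = {x}"
| "gball x (Suc i) = gball x i \<union> {w. \<exists>u\<in>gball x i. H u w}"

text \<open>The graph distance from \<open>x\<close>, meaningful only for \<open>u\<close> in some
  ball around \<open>x\<close>; hence the membership assumptions in the lemmas about it.\<close>

definition level :: "'a \<Rightarrow> 'a \<Rightarrow> nat" where
  "level x u = (LEAST i. u \<in> gball x i)"

lemma finite_nbrs: "finite {y. H x y}"
  by (rule finite_subset[OF _ finite_V]) (use edge_in_V in blast)

lemma gball_mono: "i \<le> j \<Longrightarrow> gball x i \<subseteq> gball x j"
  by (rule lift_Suc_mono_le[of "gball x"]) auto

lemma gball_subset_V: "x \<in> V \<Longrightarrow> gball x i \<subseteq> V"
  by (induction i) (use edge_in_V in auto)

lemma finite_gball: "x \<in> V \<Longrightarrow> finite (gball x i)"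
  using gball_subset_V finite_V finite_subset by metis

lemma card_gball_le: "x \<in> V \<Longrightarrow> card (gball x i) \<le> (d + 1) ^ i"
proof (induction i)
  case (Suc i)
  have "gball x (Suc i) = (\<Union>u\<in>gball x i. insert u {w. H u w})" by auto
  then have "card (gball x (Suc i)) \<le> (\<Sum>u\<in>gball x i. card (insert u {w. H u w}))"
    using card_UN_le[OF finite_gball[OF Suc.prems]] by metis
  also have "\<dots> \<le> (\<Sum>u\<in>gball x i. d + 1)"
  proof (intro sum_mono)
    fix u assume "u \<in> gball x i"
    then have "u \<in> V" using gball_subset_V[OF Suc.prems] by blast
    then show "card (insert u {w. H u w}) \<le> d + 1"
      using degree[of u] finite_nbrs[of u] by (simp add: card_insert_if)
  qed
  also have "\<dots> = card (gball x i) * (d + 1)" by simp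
  also have "\<dots> \<le> (d + 1) ^ i * (d + 1)" using Suc.IH[OF Suc.prems] by (rule mult_le_mono1)
  finally show ?case by (simp add: mult.commute)
qed simp

lemma gball_centre_swap: "u \<in> gball y j \<Longrightarrow> u \<in> gball x m \<Longrightarrow> y \<in> gball x (m + j)"
proof (induction j arbitrary: u m)
  case (Suc j)
  show ?case
  proof (cases "u \<in> gball y j")
    case True
    then show ?thesis using Suc gball_mono[of "m + j" "m + Suc j" x] by auto
  next
    case False
    then obtain w where "w \<in> gball y j" "H w u" using Suc.prems by auto
    then have "w \<in> gball x (Suc m)" using Suc.prems(2) edge_sym by auto
    then show ?thesis using Suc.IH[OF \<open>w \<in> gball y j\<close>] by (metis add_Suc_shift)
  qed
qed simp

lemma level_le: "u \<in> gball x i \<Longrightarrow> level x u \<le> i"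
  unfolding level_def by (rule Least_le)

lemma in_gball_level: "u \<in> gball x i \<Longrightarrow> u \<in> gball x (level x u)"
  unfolding level_def by (rule LeastI)

lemma in_gball_Suc_level: "u \<in> gball x i \<Longrightarrow> H u w \<Longrightarrow> w \<in> gball x (Suc (level x u))"
  using in_gball_level by auto

lemma ex_lower_neighbour:
  assumes "u \<in> gball x i" "level x u = Suc j"
  obtains w where "H u w" "w \<in> gball x j"
proof -
  have "u \<in> gball x (Suc j)" using in_gball_level[OF assms(1)] assms(2) by simp
  moreover have "u \<notin> gball x j" using level_le[of u x j] assms(2) by auto
  ultimately show ?thesis using that edge_sym by auto
qed

text \<open>By truncated subtraction the test function is constant on the ball of radius 1, so the centre, with
  \<open>d\<close> rather than at most \<open>d - 1\<close> outgoing edges, contributes nothing to the Dirichlet form.\<close>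

definition radial :: "nat \<Rightarrow> 'a \<Rightarrow> 'a \<Rightarrow> real" where
  "radial r x u = (if u \<in> gball x r then (1 / sqrt (real d - 1)) ^ (level x u - 1) else 0)"

text \<open>Positive parts charge each edge only to its endpoint with the larger value, so at a
  vertex only neighbours with smaller values need to be estimated.\<close>

lemma dirichlet_form:
  "real d * (\<Sum>u\<in>V. (f u)\<^sup>2) - qform V (adj H) f f
    = (\<Sum>u\<in>V. \<Sum>w\<in>V. adj H u w * (max 0 (f u - f w))\<^sup>2)"
proof -
  have deg: "(\<Sum>w\<in>V. adj H u w) = real d" if "u \<in> V" for u
  proof -
    have "(\<Sum>w\<in>V. adj H u w) = real (card (V \<inter> {w. H u w}))"
      by (simp add: adj_def finite_V Int_def)
    also have "V \<inter> {w. H u w} = {w. H u w}" using edge_in_V by blast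
    finally show ?thesis using degree[OF that] by simp
  qed
  have sym: "adj H u w = adj H w u" for u w using edge_sym by (auto simp: adj_def)
  have 1: "(\<Sum>u\<in>V. \<Sum>w\<in>V. adj H u w * (f u)\<^sup>2) = real d * (\<Sum>u\<in>V. (f u)\<^sup>2)"
    using deg by (simp add: sum_distrib_left flip: sum_distrib_right)
  have 2: "(\<Sum>u\<in>V. \<Sum>w\<in>V. adj H u w * (f w)\<^sup>2) = real d * (\<Sum>u\<in>V. (f u)\<^sup>2)"
    unfolding 1[symmetric] by (subst sum.swap) (simp add: sym)
  have 3: "(\<Sum>u\<in>V. \<Sum>w\<in>V. adj H u w * (max 0 (f w - f u))\<^sup>2)
      = (\<Sum>u\<in>V. \<Sum>w\<in>V. adj H u w * (max 0 (f u - f w))\<^sup>2)"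
    by (subst sum.swap) (simp add: sym)
  have "(a - b)\<^sup>2 = (max 0 (a - b))\<^sup>2 + (max 0 (b - a))\<^sup>2" for a b :: real
    by (auto simp: max_def power2_commute)
  then have "(\<Sum>u\<in>V. \<Sum>w\<in>V. adj H u w * (f u - f w)\<^sup>2)
      = 2 * (\<Sum>u\<in>V. \<Sum>w\<in>V. adj H u w * (max 0 (f u - f w))\<^sup>2)"
    using 3 by (simp add: distrib_left sum.distrib)
  moreover have "(\<Sum>u\<in>V. \<Sum>w\<in>V. adj H u w * (f u - f w)\<^sup>2)
      = 2 * (real d * (\<Sum>u\<in>V. (f u)\<^sup>2)) - 2 * qform V (adj H) f f"
    unfolding power2_diff
    using 1 2 by (simp add: distrib_left right_diff_distrib sum.distrib sum_subtractf qform_def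
        sum_distrib_left mult_ac)
  ultimately show ?thesis by simp
qed

section \<open>Estimates for the radial test function\<close>

context
  fixes r :: nat and x :: 'a
  assumes d: "2 \<le> d" and r: "1 \<le> r" and x: "x \<in> V"
begin

lemma sqrt_deg: "1 \<le> sqrt (real d - 1)" "0 < 1 / sqrt (real d - 1)" "1 / sqrt (real d - 1) \<le> 1"
  using d by auto

lemma radial_nonneg: "0 \<le> radial r x u"
  using sqrt_deg(2) by (simp add: radial_def)

lemma radial_centre: "radial r x x = 1"
proof -
  have "x \<in> gball x 0" by simp
  from level_le[OF this] gball_mono[of 0 r x] this show ?thesis by (auto simp: radial_def)
qed

lemma radial_antimono:
  "level x u \<le> j \<Longrightarrow> u \<in> gball x r \<Longrightarrow> (1 / sqrt (real d - 1)) ^ (j - 1) \<le> radial r x u"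
  unfolding radial_def using sqrt_deg by (auto intro!: power_decreasing)

text \<open>Write s for the square root of d - 1. Off the centre, a neighbour closer to
  \<open>x\<close> contributes nothing and each of the other d - 1 at most (1 - 1/s)^2 times the
  squared value, in total (s - 1)^2. On the last level the function may drop to 0, and s^2 = (s -
  1)^2 + (2s - 1) accounts for the extra term.\<close>

lemma dirichlet_radial_local:
  assumes u: "u \<in> V"
  shows "(\<Sum>w\<in>V. adj H u w * (max 0 (radial r x u - radial r x w))\<^sup>2)
    \<le> (sqrt (real d - 1) - 1)\<^sup>2 * (radial r x u)\<^sup>2
      + (if u \<in> gball x r \<and> level x u = r then (2 * sqrt (real d - 1) - 1) * (radial r x u)\<^sup>2 else 0)"
    (is "?S \<le> ?R")
proof -
  define s where "s = sqrt (real d - 1)"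
  let ?f = "radial r x"
  have s1: "1 \<le> s" using sqrt_deg by (simp add: s_def)
  have s2: "s\<^sup>2 = real d - 1" using d by (simp add: s_def)
  have "0 \<le> 2 * sqrt (real d - 1) - 1" using sqrt_deg(1) by linarith
  then have "0 \<le> (2 * sqrt (real d - 1) - 1) * (?f u)\<^sup>2" by (rule mult_nonneg_nonneg) simp
  then have R: "0 \<le> ?R" by (intro add_nonneg_nonneg) auto
  have S: "?S = (\<Sum>w\<in>{w. H u w}. (max 0 (?f u - ?f w))\<^sup>2)"
  proof -
    have "?S = (\<Sum>w\<in>V. if w \<in> {w. H u w} then (max 0 (?f u - ?f w))\<^sup>2 else 0)"
      by (intro sum.cong) (auto simp: adj_def)
    also have "\<dots> = (\<Sum>w\<in>V \<inter> {w. H u w}. (max 0 (?f u - ?f w))\<^sup>2)"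
      using finite_V by (rule sum.inter_restrict[symmetric])
    also have "V \<inter> {w. H u w} = {w. H u w}" using edge_in_V by blast
    finally show ?thesis .
  qed
  show ?thesis
  proof (cases "u \<in> gball x r")
    case False
    then have "?f u = 0" by (simp add: radial_def)
    then have "max 0 (?f u - ?f w) = 0" for w using radial_nonneg[of w] by simp
    then have "?S = 0" by simp
    then show ?thesis using R by simp
  next
    case True
    show ?thesis
    proof (cases "level x u")
      case 0
      have "?f u \<le> ?f w" if "H u w" for w
      proof -
        have "w \<in> gball x 1" using in_gball_Suc_level[OF True that] 0 by simp
        then have "level x w \<le> 1" "w \<in> gball x r" using level_le gball_mono[OF r] by blast+
        from radial_antimono[OF this] have "1 \<le> ?f w" by simp
        moreover have "?f u = 1" using True 0 by (simp add: radial_def)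
        ultimately show ?thesis by simp
      qed
      then have "max 0 (?f u - ?f w) = 0" if "H u w" for w using that by simp
      then have "?S = 0" unfolding S by simp
      then show ?thesis using R by simp
    next
      case (Suc j)
      obtain w0 where w0: "H u w0" "w0 \<in> gball x j" using ex_lower_neighbour[OF True Suc] .
      have lev: "level x u \<le> r" using level_le[OF True] .
      have fu: "?f u = (1 / s) ^ j" using True Suc by (simp add: radial_def s_def)
      have "level x w0 \<le> Suc j" "w0 \<in> gball x r"
        using level_le[OF w0(2)] gball_mono[of j r x] w0(2) lev Suc by auto
      from radial_antimono[OF this] have w0_le: "?f u \<le> ?f w0" by (simp add: fu s_def)
      have sum_le: "?S \<le> (real d - 1) * B" if "\<And>w. H u w \<Longrightarrow> (max 0 (?f u - ?f w))\<^sup>2 \<le> B" for B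
      proof -
        have "?S = (\<Sum>w\<in>{w. H u w} - {w0}. (max 0 (?f u - ?f w))\<^sup>2)"
          unfolding S using w0 w0_le finite_nbrs
          by (subst sum.remove[of _ w0]) (auto simp: max_def)
        also have "\<dots> \<le> (\<Sum>w\<in>{w. H u w} - {w0}. B)" using that by (intro sum_mono) auto
        also have "\<dots> = real (d - 1) * B"
          using w0 degree[OF u] finite_nbrs by simp
        finally show ?thesis using d by (simp add: of_nat_diff)
      qed
      show ?thesis
      proof (cases "level x u = r")
        case True
        have "?S \<le> (real d - 1) * (?f u)\<^sup>2"
        proof (rule sum_le)
          show "(max 0 (?f u - ?f w))\<^sup>2 \<le> (?f u)\<^sup>2" for w
            using radial_nonneg[of u] radial_nonneg[of w] by (intro power_mono) auto
        qed
        also have "\<dots> = ((s - 1)\<^sup>2 + (2 * s - 1)) * (?f u)\<^sup>2"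
          unfolding s2[symmetric] by (simp add: power2_diff)
        finally show ?thesis using True \<open>u \<in> gball x r\<close> by (simp add: s_def distrib_right)
      next
        case False
        then have "Suc (level x u) \<le> r" using lev by simp
        have "?S \<le> (real d - 1) * ((1 - 1 / s) * ?f u)\<^sup>2"
        proof (rule sum_le)
          fix w assume w: "H u w"
          have wb: "w \<in> gball x (Suc (level x u))" by (rule in_gball_Suc_level[OF True w])
          have "level x w \<le> Suc (Suc j)" using level_le[OF wb] Suc by simp
          moreover have "w \<in> gball x r" using wb gball_mono[OF \<open>Suc (level x u) \<le> r\<close>] by blast
          ultimately have "?f u / s \<le> ?f w" using radial_antimono[of w "Suc (Suc j)"] by (simp add: fu s_def)
          moreover have "?f u / s \<le> ?f u"
            using s1 mult_left_mono[OF s1 radial_nonneg[of u]] by (simp add: divide_le_eq)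
          ultimately show "(max 0 (?f u - ?f w))\<^sup>2 \<le> ((1 - 1 / s) * ?f u)\<^sup>2"
            by (intro power_mono) (auto simp: left_diff_distrib)
        qed
        also have "\<dots> = (s - 1)\<^sup>2 * (?f u)\<^sup>2"
          unfolding s2[symmetric] using s1 by (simp add: power_mult_distrib[symmetric] mult.assoc[symmetric] right_diff_distrib)
        finally show ?thesis using False by (simp add: s_def)
      qed
    qed
  qed
qed

definition shell :: "nat \<Rightarrow> 'a set" where
  "shell i = {u \<in> gball x r. level x u = i}"

lemma finite_shell: "finite (shell i)"
  using finite_gball[OF x] by (simp add: shell_def)

text \<open>Off the centre, one of the \<open>d\<close> edges leads back towards \<open>x\<close>,
  so at most \<open>d - 1\<close> lead to the next shell.\<close>

lemma card_shell_Suc: "1 \<le> i \<Longrightarrow> card (shell (Suc i)) \<le> (d - 1) * card (shell i)"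
proof -
  assume i: "1 \<le> i"
  have "shell (Suc i) \<subseteq> (\<Union>u\<in>shell i. {w. H u w} \<inter> shell (Suc i))"
  proof
    fix w assume w: "w \<in> shell (Suc i)"
    then have wb: "w \<in> gball x r" "level x w = Suc i" by (auto simp: shell_def)
    then obtain u where u: "H w u" "u \<in> gball x i" by (rule ex_lower_neighbour)
    have "w \<in> gball x (Suc (level x u))" using in_gball_Suc_level[OF u(2) edge_sym[OF u(1)]] .
    then have "Suc i \<le> Suc (level x u)" using level_le wb(2) by metis
    moreover have "level x u \<le> i" using u(2) by (rule level_le)
    moreover have "u \<in> gball x r" using u(2) gball_mono[of i r x] level_le[OF wb(1)] wb(2) by auto
    ultimately have "u \<in> shell i" by (simp add: shell_def)
    then show "w \<in> (\<Union>u\<in>shell i. {w. H u w} \<inter> shell (Suc i))" using w u(1) edge_sym by auto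
  qed
  then have "card (shell (Suc i)) \<le> card (\<Union>u\<in>shell i. {w. H u w} \<inter> shell (Suc i))"
    using finite_shell by (intro card_mono) auto
  also have "\<dots> \<le> (\<Sum>u\<in>shell i. card ({w. H u w} \<inter> shell (Suc i)))"
    using finite_shell by (rule card_UN_le)
  also have "\<dots> \<le> (\<Sum>u\<in>shell i. d - 1)"
  proof (intro sum_mono)
    fix u assume "u \<in> shell i"
    then have u: "u \<in> gball x r" "level x u = Suc (i - 1)" using i by (auto simp: shell_def)
    then obtain w0 where w0: "H u w0" "w0 \<in> gball x (i - 1)" by (rule ex_lower_neighbour)
    have "level x w0 \<noteq> Suc i" using level_le[OF w0(2)] by simp
    then have "card ({w. H u w} \<inter> shell (Suc i)) \<le> card ({w. H u w} - {w0})"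
      using finite_nbrs by (intro card_mono) (auto simp: shell_def)
    also have "\<dots> = d - 1"
      using w0 finite_nbrs degree[of u] gball_subset_V[OF x] u(1) by (auto simp: subset_iff)
    finally show "card ({w. H u w} \<inter> shell (Suc i)) \<le> d - 1" .
  qed
  finally show ?thesis by (simp add: mult.commute)
qed

lemma sum_radial_shell: "(\<Sum>u\<in>shell i. (radial r x u)\<^sup>2) = real (card (shell i)) * (1 / (real d - 1)) ^ (i - 1)"
proof -
  have "(radial r x u)\<^sup>2 = (1 / (real d - 1)) ^ (i - 1)" if "u \<in> shell i" for u
  proof -
    have "(radial r x u)\<^sup>2 = ((1 / sqrt (real d - 1)) ^ (i - 1))\<^sup>2"
      using that by (simp add: radial_def shell_def)
    also have "\<dots> = ((1 / sqrt (real d - 1))\<^sup>2) ^ (i - 1)"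
      by (metis power_mult mult.commute)
    also have "(1 / sqrt (real d - 1))\<^sup>2 = 1 / (real d - 1)"
      using d by (simp add: power_divide)
    finally show ?thesis .
  qed
  then show ?thesis by simp
qed

text \<open>From level 1 on, the decay of the squared function offsets the growth of the shells, so
  the mass per shell does not increase and the last of \<open>r\<close> shells carries at most an
  \<open>r\<close>-th of the total.\<close>

lemma sum_radial_last_shell:
  "real r * (\<Sum>u\<in>shell r. (radial r x u)\<^sup>2) \<le> (\<Sum>u\<in>V. (radial r x u)\<^sup>2)"
proof -
  define W where "W i = (\<Sum>u\<in>shell i. (radial r x u)\<^sup>2)" for i
  have step: "W (Suc i) \<le> W i" if "1 \<le> i" for i
  proof -
    obtain j where j: "i = Suc j" using \<open>1 \<le> i\<close> by (cases i) auto
    have "real (card (shell (Suc i))) \<le> (real d - 1) * real (card (shell i))"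
    proof -
      have "real (card (shell (Suc i))) \<le> real ((d - 1) * card (shell i))"
        using card_shell_Suc[OF that] by (rule of_nat_mono)
      then show ?thesis using d by (simp add: of_nat_diff)
    qed
    then have "real (card (shell (Suc i))) * (1 / (real d - 1)) ^ i \<le> (real d - 1) * real (card (shell i)) * (1 / (real d - 1)) ^ i"
      using d by (intro mult_right_mono) auto
    also have "\<dots> = real (card (shell i)) * (1 / (real d - 1)) ^ (i - 1)"
      using d by (simp add: j)
    finally show ?thesis by (simp add: W_def sum_radial_shell)
  qed
  have "W r \<le> W i" if "1 \<le> i" "i \<le> r" for i
    using that(2) by (induction rule: inc_induct) (use step that(1) in \<open>auto intro: order_trans\<close>)
  then have "(\<Sum>i\<in>{1..r}. W r) \<le> (\<Sum>i\<in>{1..r}. W i)" by (intro sum_mono) auto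
  also have "\<dots> = (\<Sum>u\<in>(\<Union>i\<in>{1..r}. shell i). (radial r x u)\<^sup>2)"
    unfolding W_def using finite_shell by (subst sum.UNION_disjoint) (auto simp: shell_def)
  also have "\<dots> \<le> (\<Sum>u\<in>V. (radial r x u)\<^sup>2)"
    using finite_V gball_subset_V[OF x] by (intro sum_mono2) (auto simp: shell_def)
  finally show ?thesis by (simp add: W_def)
qed

text \<open>Summing the local estimates turns the main term into d - (s - 1)^2 = 2s; the error lives
  on the last shell and costs at most the fraction 1/r.\<close>

lemma qform_radial_ge:
  "2 * sqrt (real d - 1) * (1 - 1 / real r) * (\<Sum>u\<in>V. (radial r x u)\<^sup>2)
    \<le> qform V (adj H) (radial r x) (radial r x)"
proof -
  define s where "s = sqrt (real d - 1)"
  define F where "F = (\<Sum>u\<in>V. (radial r x u)\<^sup>2)"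
  define W where "W = (\<Sum>u\<in>shell r. (radial r x u)\<^sup>2)"
  have s1: "1 \<le> s" using sqrt_deg by (simp add: s_def)
  have s2: "s\<^sup>2 = real d - 1" using d by (simp add: s_def)
  have "0 \<le> W" by (simp add: W_def sum_nonneg)
  have rW: "real r * W \<le> F" using sum_radial_last_shell by (simp add: W_def F_def)
  have "real d * F - qform V (adj H) (radial r x) (radial r x)
      \<le> (\<Sum>u\<in>V. (s - 1)\<^sup>2 * (radial r x u)\<^sup>2
        + (if u \<in> gball x r \<and> level x u = r then (2 * s - 1) * (radial r x u)\<^sup>2 else 0))"
    unfolding F_def dirichlet_form s_def by (intro sum_mono dirichlet_radial_local)
  also have "\<dots> = (s - 1)\<^sup>2 * F + (\<Sum>u\<in>V. if u \<in> shell r then (2 * s - 1) * (radial r x u)\<^sup>2 else 0)"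
    by (simp add: sum.distrib F_def sum_distrib_left shell_def)
  also have "(\<Sum>u\<in>V. if u \<in> shell r then (2 * s - 1) * (radial r x u)\<^sup>2 else 0)
      = (\<Sum>u\<in>V \<inter> shell r. (2 * s - 1) * (radial r x u)\<^sup>2)"
    using finite_V by (rule sum.inter_restrict[symmetric])
  also have "V \<inter> shell r = shell r" using gball_subset_V[OF x] by (auto simp: shell_def)
  also have "(\<Sum>u\<in>shell r. (2 * s - 1) * (radial r x u)\<^sup>2) = (2 * s - 1) * W"
    by (simp add: W_def sum_distrib_left)
  also have "(2 * s - 1) * W \<le> 2 * s * (F / real r)"
  proof (rule mult_mono)
    show "W \<le> F / real r" using rW r by (simp add: field_simps)
  qed (use s1 \<open>0 \<le> W\<close> in auto)
  finally have "(real d - (s - 1)\<^sup>2) * F - 2 * s * (F / real r) \<le> qform V (adj H) (radial r x) (radial r x)"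
    by (simp add: left_diff_distrib)
  moreover have "real d - (s - 1)\<^sup>2 = 2 * s" using s2 by (simp add: power2_diff)
  ultimately have "2 * s * F - 2 * s * (F / real r) \<le> qform V (adj H) (radial r x) (radial r x)"
    by simp
  moreover have "2 * s * (1 - 1 / real r) * F = 2 * s * F - 2 * s * (F / real r)"
    by (simp add: algebra_simps)
  ultimately show ?thesis unfolding F_def s_def by simp
qed

end

text \<open>Nilli's argument: a sum-zero combination of two radial functions with distant centres.\<close>

lemma second_eigenvalue_bound:
  assumes d: "2 \<le> d" and r: "1 \<le> r"
    and card: "(d + 1) ^ (2 * r + 1) < card V"
    and upper: "\<And>f. (\<Sum>u\<in>V. f u) = 0 \<Longrightarrow> qform V (adj H) f f \<le> \<mu> * (\<Sum>u\<in>V. (f u)\<^sup>2)"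
  shows "2 * sqrt (real d - 1) * (1 - 1 / real r) \<le> \<mu>"
proof (rule ccontr)
  assume "\<not> ?thesis"
  then have \<mu>: "\<mu> < 2 * sqrt (real d - 1) * (1 - 1 / real r)" by simp
  have "V \<noteq> {}" using card by auto
  then obtain x where x: "x \<in> V" by blast
  \<comment> \<open>\<open>V\<close> has more vertices than a ball of radius 2r + 1 can
    have.\<close>
  have "\<not> V \<subseteq> gball x (2 * r + 1)"
    using card_gball_le[OF x, of "2 * r + 1"] card card_mono[OF finite_gball[OF x], of V "2 * r + 1"] by linarith
  then obtain y where y: "y \<in> V" "y \<notin> gball x (2 * r + 1)" by blast
  define f where "f = radial r x"
  define g where "g = radial r y"
  \<comment> \<open>The supports are disjoint and not joined by an edge, so all mixed terms vanish
    below.\<close>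
  have far: "f u = 0 \<or> g w = 0" if "u = w \<or> H u w" for u w
  proof (rule ccontr)
    assume "\<not> ?thesis"
    then have "u \<in> gball x r" "w \<in> gball y r" by (auto simp: f_def g_def radial_def split: if_splits)
    then have "w \<in> gball x (r + 1)" using that by auto
    from gball_centre_swap[OF \<open>w \<in> gball y r\<close> this] have "y \<in> gball x (2 * r + 1)"
      by (simp add: mult_2 add.commute add.left_commute)
    then show False using y(2) by blast
  qed
  have pos: "0 < (\<Sum>u\<in>V. radial r z u)" "\<mu> * (\<Sum>u\<in>V. (radial r z u)\<^sup>2) < qform V (adj H) (radial r z) (radial r z)"
    if z: "z \<in> V" for z
  proof -
    note facts = radial_nonneg[OF d r z] radial_centre[OF d r z]
    show "0 < (\<Sum>u\<in>V. radial r z u)"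
      using facts z finite_V by (intro sum_pos2[of V z]) auto
    have "0 < (\<Sum>u\<in>V. (radial r z u)\<^sup>2)"
      using facts z finite_V by (intro sum_pos2[of V z]) auto
    from mult_strict_right_mono[OF \<mu> this] qform_radial_ge[OF d r z]
    show "\<mu> * (\<Sum>u\<in>V. (radial r z u)\<^sup>2) < qform V (adj H) (radial r z) (radial r z)"
      by (rule less_le_trans)
  qed
  define a where "a = (\<Sum>u\<in>V. g u)"
  define b where "b = (\<Sum>u\<in>V. f u)"
  \<comment> \<open>Exchanging the two total masses as coefficients makes the sum of
    \<open>h\<close> zero.\<close>
  define h where "h u = a * f u + (- b) * g u" for u
  have ab: "0 < a" "0 < b" using pos x y by (auto simp: a_def b_def f_def g_def)
  have "(\<Sum>u\<in>V. h u) = a * (\<Sum>u\<in>V. f u) + (- b) * (\<Sum>u\<in>V. g u)"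
    unfolding h_def sum.distrib sum_distrib_left ..
  then have "(\<Sum>u\<in>V. h u) = 0" by (simp add: a_def[symmetric] b_def[symmetric])
  then have le: "qform V (adj H) h h \<le> \<mu> * (\<Sum>u\<in>V. (h u)\<^sup>2)" by (rule upper)
  have "(h u)\<^sup>2 = a\<^sup>2 * (f u)\<^sup>2 + b\<^sup>2 * (g u)\<^sup>2" for u
    using far[of u u] by (auto simp: h_def power_mult_distrib)
  then have nh: "(\<Sum>u\<in>V. (h u)\<^sup>2) = a\<^sup>2 * (\<Sum>u\<in>V. (f u)\<^sup>2) + b\<^sup>2 * (\<Sum>u\<in>V. (g u)\<^sup>2)"
    by (simp add: sum.distrib sum_distrib_left)
  have "qform V (adj H) f g = 0"
    unfolding qform_def using far by (intro sum.neutral ballI) (auto simp: adj_def)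
  moreover have "qform V (adj H) g f = qform V (adj H) f g"
    by (rule qform_commute) (use edge_sym in \<open>auto simp: adj_def\<close>)
  ultimately have qh: "qform V (adj H) h h = a\<^sup>2 * qform V (adj H) f f + b\<^sup>2 * qform V (adj H) g g"
    unfolding h_def
    by (simp add: qform_add_left qform_add_right qform_scale_left[of V "adj H" a]
        qform_scale_left[of V "adj H" "-b"] qform_scale_right[of V "adj H" _ a]
        qform_scale_right[of V "adj H" _ "-b"] power2_eq_square del: mult_minus_left)
  have "a\<^sup>2 * (\<mu> * (\<Sum>u\<in>V. (f u)\<^sup>2)) < a\<^sup>2 * qform V (adj H) f f"
    using ab pos(2)[OF x] by (simp add: f_def)
  moreover have "b\<^sup>2 * (\<mu> * (\<Sum>u\<in>V. (g u)\<^sup>2)) < b\<^sup>2 * qform V (adj H) g g"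
    using ab pos(2)[OF y(1)] by (simp add: g_def)
  ultimately show False using le nh qh by (simp add: algebra_simps)
qed

end

section \<open>The complement\<close>

context form_bounded_graph
begin

definition complement :: "nat \<Rightarrow> nat \<Rightarrow> bool" where
  "complement x y \<longleftrightarrow> x \<in> V \<and> y \<in> V \<and> x \<noteq> y \<and> \<not> E x y"

text \<open>The two adjacency matrices and the identity add up to the all-ones matrix, whose form
  vanishes on functions with sum zero.\<close>

lemma complement_form_le:
  assumes "(\<Sum>i\<in>V. f i) = 0"
  shows "qform V (adj complement) f f \<le> (real l - 1) * (\<Sum>i\<in>V. (f i)\<^sup>2)"
proof -
  have "qform V (adj complement) f f + qform V (adj E) f f + (\<Sum>i\<in>V. (f i)\<^sup>2)
      = (\<Sum>i\<in>V. \<Sum>j\<in>V. f i * f j)"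
  proof -
    have "(\<Sum>i\<in>V. (f i)\<^sup>2) = (\<Sum>i\<in>V. \<Sum>j\<in>V. if i = j then f i * f j else 0)"
      using finite_V by (simp add: power2_eq_square)
    then have "qform V (adj complement) f f + qform V (adj E) f f + (\<Sum>i\<in>V. (f i)\<^sup>2)
      = (\<Sum>i\<in>V. \<Sum>j\<in>V. adj complement i j * f i * f j + adj E i j * f i * f j
          + (if i = j then f i * f j else 0))"
      unfolding qform_def by (simp only: sum.distrib)
    also have "\<dots> = (\<Sum>i\<in>V. \<Sum>j\<in>V. f i * f j)"
      by (intro sum.cong refl) (auto simp: adj_def complement_def edge_irrefl)
    finally show ?thesis .
  qed
  also have "\<dots> = (\<Sum>i\<in>V. f i) * (\<Sum>j\<in>V. f j)" by (rule sum_product[symmetric])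
  finally show ?thesis using form_ge[of f] assms by (simp add: left_diff_distrib)
qed

lemma regular_graph_complement:
  assumes deg: "\<And>x. x \<in> V \<Longrightarrow> card (nb x) = k"
  shows "regular_graph V complement (card V - k - 1)"
proof
  fix x assume x: "x \<in> V"
  have "{y. complement x y} = V - nb x - {x}" using x by (auto simp: complement_def)
  moreover have "x \<in> V - nb x" using x edge_irrefl by simp
  ultimately show "card {y. complement x y} = card V - k - 1"
    using deg[OF x] nb_subset_V by (simp add: card_Diff_singleton card_Diff_subset)
qed (auto simp: complement_def finite_V edge_sym)

text \<open>Both sides are integers, so a violation is by at least 1. The Alon--Boppana error is
  less than that for a radius proportional to the bound \<open>R\<close> on the degree of the
  complement.\<close>

lemma codegree_le:
  assumes deg: "\<And>x. x \<in> V \<Longrightarrow> card (nb x) = k" and R: "card V < k + R"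
    and large: "(R + 1) ^ (2 * (8 * R + 1) + 1) < card V"
  shows "4 * (real (card V - k - 1) - 1) \<le> (real l - 1)\<^sup>2"
proof (rule ccontr)
  define d where "d = card V - k - 1"
  \<comment> \<open>With \<open>d\<close> at most \<open>R\<close>, this makes the squared error 8(d
    - 1)/r smaller than 1.\<close>
  define r where "r = 8 * R + 1"
  define s where "s = sqrt (real d - 1)"
  assume "\<not> ?thesis"
  then have neg: "(real l - 1)\<^sup>2 < 4 * (real d - 1)" by (simp add: d_def)
  then have "0 < 4 * (real d - 1)" using zero_le_power2 by (rule le_less_trans[rotated])
  then have d2: "2 \<le> d" by simp
  \<comment> \<open>Passing to integers turns the strict inequality into a gap of 1.\<close>
  have "of_int ((int l - 1)\<^sup>2) < (of_int (4 * (int d - 1)) :: real)" using neg by simp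
  then have "(int l - 1)\<^sup>2 + 1 \<le> 4 * (int d - 1)" by linarith
  then have "real_of_int ((int l - 1)\<^sup>2 + 1) \<le> real_of_int (4 * (int d - 1))" by linarith
  then have gap: "(real l - 1)\<^sup>2 + 1 \<le> 4 * (real d - 1)" by simp
  have dR: "d \<le> R" using R by (simp add: d_def)
  interpret complement: regular_graph V complement d
    unfolding d_def using deg by (rule regular_graph_complement)
  have "(d + 1) ^ (2 * r + 1) \<le> (R + 1) ^ (2 * r + 1)" using dR by (intro power_mono) auto
  also have "\<dots> < card V" using large by (simp add: r_def)
  finally have "2 * s * (1 - 1 / real r) \<le> real l - 1"
    unfolding s_def using d2 complement_form_le
    by (intro complement.second_eigenvalue_bound) (auto simp: r_def)
  moreover have "0 \<le> 2 * s * (1 - 1 / real r)"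
    using d2 by (simp add: s_def r_def)
  ultimately have "(2 * s * (1 - 1 / real r))\<^sup>2 \<le> (real l - 1)\<^sup>2" by (rule power_mono)
  then have "4 * s\<^sup>2 * (1 - 1 / real r)\<^sup>2 \<le> 4 * (real d - 1) - 1"
    using gap by (simp add: power_mult_distrib)
  moreover have "1 - 2 / real r \<le> (1 - 1 / real r)\<^sup>2" by (simp add: power2_diff)
  then have "4 * s\<^sup>2 * (1 - 2 / real r) \<le> 4 * s\<^sup>2 * (1 - 1 / real r)\<^sup>2"
    by (intro mult_left_mono) auto
  ultimately have "4 * s\<^sup>2 * (1 - 2 / real r) \<le> 4 * (real d - 1) - 1"
    by (rule order_trans[rotated])
  moreover have s2: "s\<^sup>2 = real d - 1" using d2 by (simp add: s_def)
  moreover have "4 * s\<^sup>2 * (1 - 2 / real r) = 4 * s\<^sup>2 - 8 * s\<^sup>2 / real r"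
    by (simp add: algebra_simps)
  ultimately have "1 \<le> 8 * s\<^sup>2 / real r" by simp
  then have "real r \<le> 8 * s\<^sup>2" by (simp add: r_def field_simps)
  then show False using dR by (simp add: s2 r_def)
qed

end

section \<open>Combining the two cases\<close>

lemma sesqui_regular_form_bounded_graph:
  assumes "sesqui_regular v E k c" "2 \<le> l" "lambda_min (adjacency_matrix v E) \<ge> - real l"
  shows "form_bounded_graph {..<v} E l"
proof
  have g: "simple_graph v E" using assms(1) by (simp add: sesqui_regular_def)
  show "- real l * (\<Sum>i<v. (f i)\<^sup>2) \<le> qform {..<v} (adj E) f f" for f
  proof -
    have "- real l * (\<Sum>i<v. (f i)\<^sup>2) \<le> lambda_min (adjacency_matrix v E) * (\<Sum>i<v. (f i)\<^sup>2)"
      using assms(3) by (intro mult_right_mono sum_nonneg) auto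
    also have "\<dots> \<le> qform {..<v} (adj E) f f" using g by (rule lambda_min_le_form)
    finally show ?thesis .
  qed
qed (use assms in \<open>auto simp: sesqui_regular_def simple_graph_def\<close>)

theorem theorem1p5:
  fixes l :: int
  assumes "l \<ge> 2"
  shows "\<exists>C::real. \<forall>(v::nat) (E::nat \<Rightarrow> nat \<Rightarrow> bool) (k::nat) (c::nat).
           sesqui_regular v E k c \<and> connected_graph v E \<and>
           lambda_min (adjacency_matrix v E) \<ge> - real_of_int l \<and> real k \<ge> C
           \<longrightarrow> int c \<le> l^2 * (l - 1) \<or>
               real v - real k - 1 \<le> real_of_int ((l - 1)^2) / 4 + 1"
proof -
  define m where "m = nat l"
  have m: "l = int m" "2 \<le> m" using assms by (auto simp: m_def)
  \<comment> \<open>The boundary between the cases: more than \<open>D\<close> common neighbours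
    contain a clique of size \<open>block_clique_size\<close>.\<close>
  define D where "D = ramsey_bound (form_bounded_graph.block_clique_size m) (m\<^sup>2 + 1)"
  define R where "R = form_bounded_graph.nonneighbour_bound m"
  \<comment> \<open>The summands provide, in turn, the initial clique for \<open>c\<close> above
    \<open>D\<close>, the initial clique for \<open>c\<close> up to \<open>D\<close>, and enough
    vertices for the Alon--Boppana bound.\<close>
  define C where "C = D + ramsey_bound (form_bounded_graph.initial_clique_size m D) (m\<^sup>2 + 1)
    + (R + 1) ^ (2 * (8 * R + 1) + 1)"
  have "int c \<le> l^2 * (l - 1) \<or> real v - real k - 1 \<le> real_of_int ((l - 1)^2) / 4 + 1"
    if sesqui: "sesqui_regular v E k c" and conn: "connected_graph v E"
      and min: "lambda_min (adjacency_matrix v E) \<ge> - real_of_int l" and k: "real k \<ge> real C"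
    for v k c :: nat and E
  \<comment> \<open>If \<open>v\<close> is at most \<open>k + 1\<close>, alternative (ii) is
    immediate; this also disposes of \<open>v = 0\<close> and makes \<open>v - k - 1\<close> a
    genuine subtraction afterwards.\<close>
  proof (cases "v \<le> k + 1")
    case True
    then have "real v - real k - 1 \<le> 0" by linarith
    also have "0 \<le> real_of_int ((l - 1)^2) / 4 + 1" by simp
    finally show ?thesis by blast
  next
    case False
    interpret form_bounded_graph "{..<v}" E m
      using sesqui m(2) min by (intro sesqui_regular_form_bounded_graph) (auto simp: m(1))
    have nb_eq: "neighbours v E x = nb x" for x
      using edge_in_V by (auto simp: neighbours_def)
    have deg: "card (nb x) = k" if "x \<in> {..<v}" for x
      using sesqui that by (simp add: sesqui_regular_def nb_eq)
    have conn': "E\<^sup>*\<^sup>* x y" if "x \<in> {..<v}" "y \<in> {..<v}" for x y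
      using conn that by (simp add: connected_graph_def)
    have common: "card (nb x \<inter> nb y) = c" if "E x z" "E z y" "x \<noteq> y" "\<not> E x y" for x y z
    proof -
      have "dist2 v E x y" using that edge_in_V by (auto simp: dist2_def)
      then show ?thesis using sesqui by (simp add: sesqui_regular_def nb_eq)
    qed
    have x: "0 \<in> {..<v}" using False by simp
    have k: "C \<le> k" using k by simp
    show ?thesis
    proof (cases "c \<le> D")
      case True
      have "c \<le> m\<^sup>2 * (m - 1)"
      proof (rule common_neighbours_le[OF conn' common True x deg])
        show "ramsey_bound (initial_clique_size D) (m\<^sup>2 + 1) \<le> k" using k by (simp add: C_def)
        show "k + 1 < card {..<v}" using False by simp
      qed
      then have "int c \<le> int (m\<^sup>2 * (m - 1))" by (rule of_nat_mono)
      also have "\<dots> = l\<^sup>2 * (l - 1)" using m by (simp add: of_nat_diff)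
      finally show ?thesis ..
    next
      case False
      have "card {..<v} < k + nonneighbour_bound"
      proof (rule card_V_if_many_common_neighbours[OF conn' _ x deg])
        show "ramsey_bound block_clique_size (m\<^sup>2 + 1) \<le> k" using k by (simp add: C_def D_def)
        show "ramsey_bound block_clique_size (m\<^sup>2 + 1) \<le> card (nb x \<inter> nb y)"
          if "E x z" "E z y" "x \<noteq> y" "\<not> E x y" for x y z
          using common[OF that] False by (simp add: D_def)
      qed
      then have "card {..<v} < k + R" by (simp add: R_def)
      moreover have "(R + 1) ^ (2 * (8 * R + 1) + 1) < card {..<v}"
        using k \<open>\<not> v \<le> k + 1\<close> by (simp add: C_def)
      ultimately have "4 * (real (card {..<v} - k - 1) - 1) \<le> (real m - 1)\<^sup>2"
        using deg by (intro codegree_le)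
      moreover have "real (card {..<v} - k - 1) = real v - real k - 1"
        using \<open>\<not> v \<le> k + 1\<close> by (simp add: of_nat_diff)
      ultimately have "real v - real k - 1 \<le> (real m - 1)\<^sup>2 / 4 + 1" by simp
      also have "(real m - 1)\<^sup>2 = real_of_int ((l - 1)^2)" by (simp add: m(1))
      finally show ?thesis ..
    qed
  qed
  then show ?thesis by (intro exI[of _ "real C"]) blast
qed

end
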